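(* Assume the standing setting and Assumptions (A1)–(A2) described in the context. Suppose there is a constant $r>0$ such that $\mathcal{J}^0(N,0;u)\ge r\,\mathbb{E}\big[\sum_{k=0}^{N-1}|u_k|^2\big]$ for all $u\in\mathcal{U}$. Then for every $\xi\in L^2_{\mathcal{F}_{N-1}}(\Omega;\mathbb{R}^n)$, the functional $u\mapsto\mathcal{J}(N,\xi;u)$ is strictly convex and coercive on $\mathcal{U}$, i.e. $\mathcal{J}(N,\xi;u)\to\infty$ as $\|u\|_{\mathcal{U}}\to\infty$.
   Context: Fix integers $N\ge 1$, $n,m\ge1$, $\mathcal{T}=\{0,\dots,N-1\}$. $(\Omega,\mathcal{F},\mathbb{P})$ complete with scalar sequence $\{\omega_k\}_{k\in\mathcal{T}}$, $\mathcal{F}_k=\sigma\{\omega_0,\dots,\omega_k\}$ (completed), $\mathcal{F}_{-1}$ trivial, $\mathbb{E}[\omega_k\mid\mathcal{F}_{k-1}]=0$, $\mathbb{E}[\omega_k^2\mid\mathcal{F}_{k-1}]=1$. $\mathbb{E}_{k-1}[\cdot]=\mathbb{E}[\cdot\mid\mathcal{F}_{k-1}]$. $L^2_{\mathcal{F}_{N-1}}(\Omega;\mathbb{R}^n)$ = square-integrable $\mathcal{F}_{N-1}$-measurable vectors; $L^2_{\mathbb{F}}(\mathcal{T};\mathbb{R}^d)$ = processes $(h_k)_{k\in\mathcal{T}}$, $h_k$ $\mathcal{F}_{k-1}$-measurable, $\mathbb{E}\sum|h_k|^2<\infty$. $\mathcal{U}=L^2_{\mathbb{F}}(\mathcal{T};\mathbb{R}^m)$,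 $\|u\|_{\mathcal{U}}^2=\mathbb{E}\sum_k|u_k|^2$. (A1): $A_k,C_k\in\mathbb{R}^{n\times n}$, $B_k\in\mathbb{R}^{n\times m}$ deterministic; $q\in L^2_{\mathbb{F}}(\mathcal{T};\mathbb{R}^n)$. (A2): $G_0\in\mathbb{S}^n$, $Q_k\in\mathbb{S}^n$, $R_k\in\mathbb{S}^m$, $S_k\in\mathbb{R}^{m\times n}$ deterministic; $\eta\in L^2_{\mathbb{F}}(\mathcal{T};\mathbb{R}^n)$, $\rho\in L^2_{\mathbb{F}}(\mathcal{T};\mathbb{R}^m)$. State equation: $y_k=A_k\mathbb{E}_{k-1}[y_{k+1}]+B_ku_k+C_k\mathbb{E}_{k-1}[y_{k+1}\omega_k]+q_k$ ($k\in\mathcal{T}$), $y_N=\xi$, with unique adapted square-integrable solution $y^{(\xi,u)}$. Cost: $\mathcal{J}(N,\xi;u)=\frac12\mathbb{E}\{\langle G_0y_0,y_0\rangle+\sum_{k=0}^{N-1}[\langle Q_k\bar y_k,\bar y_k\rangle+2\langle S_k\bar y_k,u_k\rangle+\langle R_ku_k,u_k\rangle+2\langle\eta_k,\bar y_k\rangle+2\langle\rho_k,u_k\rangle]\}$, $\bar y_k=\mathbb{E}_{k-1}[y_{k+1}]$, $y=y^{(\xi,u)}$. $\mathcal{J}^0(N,0;v)=\frac12\mathbb{E}\{\langle G_0y_0,y_0\rangle+\sum_{k=0}^{N-1}[\langle Q_k\bar y_k,\bar y_k\rangle+2\langle S_k\bar y_k,v_k\rangle+\langle R_kv_k,v_k\rangle]\}$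 where $y$ solves $y_k=A_k\mathbb{E}_{k-1}[y_{k+1}]+B_kv_k+C_k\mathbb{E}_{k-1}[y_{k+1}\omega_k]$, $y_N=0$. *)

theory Defs
  imports "HOL-Probability.Probability"
begin

text \<open>Fm M w k is the sigma-algebra F_{k-1}: for k = 0 the trivial one,
  for k \<ge> 1 the completion (by the null sets of M) of the sigma-algebra
  generated by w_0, ..., w_{k-1}.\<close>
definition Fm :: "'a measure \<Rightarrow> (nat \<Rightarrow> 'a \<Rightarrow> real) \<Rightarrow> nat \<Rightarrow> 'a measure" where
  "Fm M w k = (if k = 0 then sigma (space M) {}
     else sigma (space M)
       ({w i -` B \<inter> space M | i B. i < k \<and> B \<in> sets borel} \<union> null_sets M))"

text \<open>Componentwise conditional expectation of a random vector.\<close>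
definition vcexp :: "'a measure \<Rightarrow> 'a measure \<Rightarrow> ('a \<Rightarrow> real^'d) \<Rightarrow> 'a \<Rightarrow> real^'d" where
  "vcexp M F f = (\<lambda>x. \<chi> i. real_cond_exp M F (\<lambda>z. f z $ i) x)"

text \<open>L^2_F(T;R^d): h_k is F_{k-1}-measurable and square integrable, k < N.\<close>
definition L2F :: "'a measure \<Rightarrow> (nat \<Rightarrow> 'a \<Rightarrow> real) \<Rightarrow> nat \<Rightarrow> (nat \<Rightarrow> 'a \<Rightarrow> real^'d) set" where
  "L2F M w N = {h. \<forall>k<N. h k \<in> borel_measurable (Fm M w k) \<and>
                          integrable M (\<lambda>x. (norm (h k x))\<^sup>2)}"

text \<open>Norm on U: sqrt (E sum_{k<N} |u_k|^2).\<close>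
definition Unorm :: "'a measure \<Rightarrow> nat \<Rightarrow> (nat \<Rightarrow> 'a \<Rightarrow> real^'d) \<Rightarrow> real" where
  "Unorm M N u = sqrt (integral\<^sup>L M (\<lambda>x. \<Sum>k<N. (norm (u k x))\<^sup>2))"

text \<open>Backward recursion of the state equation: ybw ... j = y_{N-j}.\<close>
primrec ybw :: "'a measure \<Rightarrow> (nat \<Rightarrow> 'a \<Rightarrow> real) \<Rightarrow> nat \<Rightarrow> (nat \<Rightarrow> real^'n^'n) \<Rightarrow>
    (nat \<Rightarrow> real^'m^'n) \<Rightarrow> (nat \<Rightarrow> real^'n^'n) \<Rightarrow> (nat \<Rightarrow> 'a \<Rightarrow> real^'n) \<Rightarrow>
    ('a \<Rightarrow> real^'n) \<Rightarrow> (nat \<Rightarrow> 'a \<Rightarrow> real^'m) \<Rightarrow> nat \<Rightarrow> 'a \<Rightarrow> real^'n" where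
  "ybw M w N A B C q \<xi> u 0 = \<xi>"
| "ybw M w N A B C q \<xi> u (Suc j) =
     (\<lambda>x. A (N - Suc j) *v vcexp M (Fm M w (N - Suc j)) (ybw M w N A B C q \<xi> u j) x
        + B (N - Suc j) *v u (N - Suc j) x
        + C (N - Suc j) *v vcexp M (Fm M w (N - Suc j))
              (\<lambda>z. w (N - Suc j) z *\<^sub>R ybw M w N A B C q \<xi> u j z) x
        + q (N - Suc j) x)"

text \<open>The state y_k, k \<le> N, with y_N = xi.\<close>
definition state :: "'a measure \<Rightarrow> (nat \<Rightarrow> 'a \<Rightarrow> real) \<Rightarrow> nat \<Rightarrow> (nat \<Rightarrow> real^'n^'n) \<Rightarrow>
    (nat \<Rightarrow> real^'m^'n) \<Rightarrow> (nat \<Rightarrow> real^'n^'n) \<Rightarrow> (nat \<Rightarrow> 'a \<Rightarrow> real^'n) \<Rightarrow>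
    ('a \<Rightarrow> real^'n) \<Rightarrow> (nat \<Rightarrow> 'a \<Rightarrow> real^'m) \<Rightarrow> nat \<Rightarrow> 'a \<Rightarrow> real^'n" where
  "state M w N A B C q \<xi> u k = ybw M w N A B C q \<xi> u (N - k)"

text \<open>The cost functional J(N, xi; u).\<close>
definition cost :: "'a measure \<Rightarrow> (nat \<Rightarrow> 'a \<Rightarrow> real) \<Rightarrow> nat \<Rightarrow> (nat \<Rightarrow> real^'n^'n) \<Rightarrow>
    (nat \<Rightarrow> real^'m^'n) \<Rightarrow> (nat \<Rightarrow> real^'n^'n) \<Rightarrow> (nat \<Rightarrow> 'a \<Rightarrow> real^'n) \<Rightarrow>
    real^'n^'n \<Rightarrow> (nat \<Rightarrow> real^'n^'n) \<Rightarrow> (nat \<Rightarrow> real^'n^'m) \<Rightarrow> (nat \<Rightarrow> real^'m^'m) \<Rightarrow>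
    (nat \<Rightarrow> 'a \<Rightarrow> real^'n) \<Rightarrow> (nat \<Rightarrow> 'a \<Rightarrow> real^'m) \<Rightarrow>
    ('a \<Rightarrow> real^'n) \<Rightarrow> (nat \<Rightarrow> 'a \<Rightarrow> real^'m) \<Rightarrow> real" where
  "cost M w N A B C q G0 Q S R \<eta> \<rho> \<xi> u =
     (let y = state M w N A B C q \<xi> u;
          yb = (\<lambda>k. vcexp M (Fm M w k) (y (Suc k)))
      in 1/2 * integral\<^sup>L M (\<lambda>x. (G0 *v y 0 x) \<bullet> y 0 x +
           (\<Sum>k<N. (Q k *v yb k x) \<bullet> yb k x + 2 * ((S k *v yb k x) \<bullet> u k x)
               + (R k *v u k x) \<bullet> u k x + 2 * (\<eta> k x \<bullet> yb k x) + 2 * (\<rho> k x \<bullet> u k x))))"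

end

theory Submission
  imports Defs
begin

text \<open>Conditional expectation is linear, so the state depends affinely on \<open>(\<xi>, q, u)\<close>
  almost surely, and \<open>J(N, \<xi>; \<cdot>)\<close> is a quadratic functional whose quadratic part is
  \<open>J\<^sup>0(N, 0; \<cdot>)\<close>. Hence, for every \<open>t\<close>,
  \<open>J(t u + (1 - t) v) = t J(u) + (1 - t) J(v) - t (1 - t) J\<^sup>0(u - v)\<close>,
  and \<open>J\<^sup>0(u - v) \<ge> r \<parallel>u - v\<parallel>\<^sup>2 > 0\<close> gives strict convexity.

  For coercivity, split the state into the part driven by the data \<open>(\<xi>, q)\<close> and the part
  driven by \<open>u\<close>. Neither \<open>E\<^sub>k\<^sub>-\<^sub>1[\<cdot>]\<close> nor \<open>E\<^sub>k\<^sub>-\<^sub>1[\<omega>\<^sub>k \<cdot>]\<close> increases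
  \<open>L\<^sup>2\<close> norms (the latter by conditional Cauchy--Schwarz, since \<open>E\<^sub>k\<^sub>-\<^sub>1[\<omega>\<^sub>k\<^sup>2] = 1\<close>),
  so the second part is bounded in \<open>L\<^sup>2\<close> by a multiple of \<open>\<parallel>u\<parallel>\<close>. Young's inequality then
  bounds the cross terms by \<open>\<epsilon> \<parallel>u\<parallel>\<^sup>2 + C\<^sub>\<epsilon>\<close>, whence
  \<open>J(u) \<ge> J(0) + J\<^sup>0(u) - \<epsilon> \<parallel>u\<parallel>\<^sup>2 - C\<^sub>\<epsilon> \<ge> (r - \<epsilon>) \<parallel>u\<parallel>\<^sup>2 - C\<^sub>\<epsilon>\<close>.\<close>

section \<open>Square-integrable random vectors\<close>

definition square_integrable :: "'a measure \<Rightarrow> ('a \<Rightarrow> 'b::euclidean_space) \<Rightarrow> bool" where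
  "square_integrable M f \<longleftrightarrow> f \<in> borel_measurable M \<and> integrable M (\<lambda>x. (norm (f x))\<^sup>2)"

lemma norm_add_square_le: "(norm (a + b))\<^sup>2 \<le> 2 * (norm a)\<^sup>2 + 2 * (norm b)\<^sup>2"
  for a b :: "'b::real_normed_vector"
proof -
  have "(norm (a + b))\<^sup>2 \<le> (norm a + norm b)\<^sup>2"
    by (rule power_mono[OF norm_triangle_ineq]) simp
  also have "\<dots> \<le> 2 * (norm a)\<^sup>2 + 2 * (norm b)\<^sup>2"
    using sum_squares_bound[of "norm a" "norm b"] by (simp add: power2_sum)
  finally show ?thesis .
qed

lemma norm_square_sum3_le:
  "(norm (a + b + c))\<^sup>2 \<le> 4 * ((norm a)\<^sup>2 + (norm b)\<^sup>2 + (norm c)\<^sup>2)"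
  for a b c :: "'b::real_normed_vector"
  unfolding distrib_left
  using norm_add_square_le[of "a + b" c] norm_add_square_le[of a b] zero_le_power2[of "norm c"]
  by linarith

lemma abs_mult_le_sum_squares: "\<bar>a * b\<bar> \<le> a\<^sup>2 + b\<^sup>2" for a b :: real
proof -
  have "2 * \<bar>a\<bar> * \<bar>b\<bar> \<le> a\<^sup>2 + b\<^sup>2"
    using sum_squares_bound[of "\<bar>a\<bar>" "\<bar>b\<bar>"] by simp
  moreover have "0 \<le> \<bar>a\<bar> * \<bar>b\<bar>" by simp
  ultimately show ?thesis unfolding abs_mult by linarith
qed

lemma norm_mat_vec_le: "norm (A *v x) \<le> onorm ((*v) A) * norm x"
  for A :: "real^'p^'q"
  by (rule onorm) simp

lemma onorm_mat_vec_nonneg: "0 \<le> onorm ((*v) X)" for X :: "real^'p^'q"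
  by (rule onorm_pos_le) simp

lemma norm_mat_vec_le_of_onorm_le:
  fixes X :: "real^'p^'q"
  assumes "onorm ((*v) X) \<le> K"
  shows "norm (X *v x) \<le> K * norm x"
  using norm_mat_vec_le[of X x] mult_right_mono[OF assms norm_ge_zero[of x]] by linarith

lemma norm_mat_vec_square_le: "(norm (A *v x))\<^sup>2 \<le> (onorm ((*v) A))\<^sup>2 * (norm x)\<^sup>2"
  for A :: "real^'p^'q"
  by (metis norm_mat_vec_le norm_ge_zero power_mono power_mult_distrib)

lemma norm_mat_vec_sum3_square_le:
  fixes A :: "real^'p^'q" and B :: "real^'r^'q" and C :: "real^'s^'q"
  shows "(norm (A *v a + B *v b + C *v c))\<^sup>2
    \<le> 4 * ((onorm ((*v) A))\<^sup>2 * (norm a)\<^sup>2 + (onorm ((*v) B))\<^sup>2 * (norm b)\<^sup>2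
      + (onorm ((*v) C))\<^sup>2 * (norm c)\<^sup>2)"
  using norm_square_sum3_le[of "A *v a" "B *v b" "C *v c"] norm_mat_vec_square_le[of A a]
    norm_mat_vec_square_le[of B b] norm_mat_vec_square_le[of C c]
  unfolding distrib_left by linarith

lemma borel_measurable_vec_lambda:
  fixes f :: "'d::finite \<Rightarrow> 'a \<Rightarrow> real"
  assumes "\<And>i. f i \<in> borel_measurable M"
  shows "(\<lambda>x. \<chi> i. f i x) \<in> borel_measurable M"
proof (subst borel_measurable_euclidean_space, intro ballI)
  fix b :: "real^'d" assume "b \<in> Basis"
  then obtain i where "b = axis i 1" unfolding Basis_vec_def by auto
  then show "(\<lambda>x. (\<chi> i. f i x) \<bullet> b) \<in> borel_measurable M"
    using assms by (simp add: inner_axis)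
qed

lemma borel_measurable_vec_nth [measurable]:
  fixes f :: "'a \<Rightarrow> real^'d"
  assumes [measurable]: "f \<in> borel_measurable M"
  shows "(\<lambda>x. f x $ i) \<in> borel_measurable M"
  unfolding cart_eq_inner_axis by measurable

lemma borel_measurable_mat_vec [measurable]:
  fixes A :: "real^'p^'q"
  assumes "f \<in> borel_measurable M"
  shows "(\<lambda>x. A *v f x) \<in> borel_measurable M"
  by (rule borel_measurable_continuous_on[OF matrix_vector_mult_linear_continuous_on assms])

lemma square_integrable_zero [simp]: "square_integrable M (\<lambda>x. 0)"
  by (simp add: square_integrable_def)

lemma square_integrable_add:
  assumes "square_integrable M f" "square_integrable M g"
  shows "square_integrable M (\<lambda>x. f x + g x)"
proof -
  have [measurable]: "f \<in> borel_measurable M" "g \<in> borel_measurable M"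
    using assms by (auto simp: square_integrable_def)
  have "integrable M (\<lambda>x. (norm (f x + g x))\<^sup>2)"
  proof (rule Bochner_Integration.integrable_bound)
    show "integrable M (\<lambda>x. 2 * (norm (f x))\<^sup>2 + 2 * (norm (g x))\<^sup>2)"
      using assms by (simp add: square_integrable_def)
    show "AE x in M. norm ((norm (f x + g x))\<^sup>2) \<le> norm (2 * (norm (f x))\<^sup>2 + 2 * (norm (g x))\<^sup>2)"
      using norm_add_square_le by (intro AE_I2) simp
  qed measurable
  then show ?thesis by (simp add: square_integrable_def)
qed

lemma square_integrable_scaleR:
  "square_integrable M f \<Longrightarrow> square_integrable M (\<lambda>x. c *\<^sub>R f x)"
  by (auto simp: square_integrable_def power_mult_distrib)

lemma square_integrable_lincomb:
  "square_integrable M f \<Longrightarrow> square_integrable M g \<Longrightarrow>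
    square_integrable M (\<lambda>x. a *\<^sub>R f x + b *\<^sub>R g x)"
  by (intro square_integrable_add square_integrable_scaleR)

lemma square_integrable_diff:
  "square_integrable M f \<Longrightarrow> square_integrable M g \<Longrightarrow> square_integrable M (\<lambda>x. f x - g x)"
  using square_integrable_lincomb[of M f g 1 "-1"] by simp

lemma square_integrable_mat_vec:
  fixes A :: "real^'p^'q" and f :: "'a \<Rightarrow> real^'p"
  assumes "square_integrable M f"
  shows "square_integrable M (\<lambda>x. A *v f x)"
proof -
  have [measurable]: "f \<in> borel_measurable M" using assms by (simp add: square_integrable_def)
  have "integrable M (\<lambda>x. (norm (A *v f x))\<^sup>2)"
  proof (rule Bochner_Integration.integrable_bound)
    show "integrable M (\<lambda>x. (onorm ((*v) A))\<^sup>2 * (norm (f x))\<^sup>2)"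
      using assms by (simp add: square_integrable_def)
    show "AE x in M. norm ((norm (A *v f x))\<^sup>2) \<le> norm ((onorm ((*v) A))\<^sup>2 * (norm (f x))\<^sup>2)"
      using norm_mat_vec_square_le by (intro AE_I2) simp
  qed measurable
  then show ?thesis by (simp add: square_integrable_def)
qed

lemma square_integrable_component:
  fixes f :: "'a \<Rightarrow> real^'d"
  assumes "square_integrable M f"
  shows "square_integrable M (\<lambda>x. f x $ i)"
proof -
  have [measurable]: "f \<in> borel_measurable M" using assms by (simp add: square_integrable_def)
  have "integrable M (\<lambda>x. (f x $ i)\<^sup>2)"
  proof (rule Bochner_Integration.integrable_bound)
    show "integrable M (\<lambda>x. (norm (f x))\<^sup>2)" using assms by (simp add: square_integrable_def)
    show "AE x in M. norm ((f x $ i)\<^sup>2) \<le> norm ((norm (f x))\<^sup>2)"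
      using power_mono[OF component_le_norm_cart abs_ge_zero, of "f _" i 2] by (intro AE_I2) simp
  qed measurable
  then show ?thesis by (simp add: square_integrable_def)
qed

lemma integrable_inner_square_integrable:
  fixes f g :: "'a \<Rightarrow> 'b::euclidean_space"
  assumes "square_integrable M f" "square_integrable M g"
  shows "integrable M (\<lambda>x. f x \<bullet> g x)"
proof (rule Bochner_Integration.integrable_bound)
  show "integrable M (\<lambda>x. (norm (f x))\<^sup>2 + (norm (g x))\<^sup>2)"
    using assms by (simp add: square_integrable_def)
  show "(\<lambda>x. f x \<bullet> g x) \<in> borel_measurable M"
    using assms by (auto simp: square_integrable_def intro: borel_measurable_inner)
  show "AE x in M. norm (f x \<bullet> g x) \<le> norm ((norm (f x))\<^sup>2 + (norm (g x))\<^sup>2)"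
  proof (intro AE_I2)
    fix x
    have "\<bar>f x \<bullet> g x\<bar> \<le> norm (f x) * norm (g x)" by (rule Cauchy_Schwarz_ineq2)
    also have "\<dots> \<le> (norm (f x))\<^sup>2 + (norm (g x))\<^sup>2"
      using abs_mult_le_sum_squares[of "norm (f x)" "norm (g x)"] by simp
    finally show "norm (f x \<bullet> g x) \<le> norm ((norm (f x))\<^sup>2 + (norm (g x))\<^sup>2)" by simp
  qed
qed

lemma (in finite_measure) integrable_square_integrable:
  fixes f :: "'a \<Rightarrow> real"
  assumes "square_integrable M f"
  shows "integrable M f"
proof (rule Bochner_Integration.integrable_bound)
  show "integrable M (\<lambda>x. 1 + (f x)\<^sup>2)" using assms by (simp add: square_integrable_def)
  show "f \<in> borel_measurable M" using assms by (simp add: square_integrable_def)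
  show "AE x in M. norm (f x) \<le> norm (1 + (f x)\<^sup>2)"
    using abs_mult_le_sum_squares[of 1] by (intro AE_I2) simp
qed

lemma integrable_mult_square_integrable:
  fixes f g :: "'a \<Rightarrow> real"
  shows "square_integrable M f \<Longrightarrow> square_integrable M g \<Longrightarrow> integrable M (\<lambda>x. f x * g x)"
  using integrable_inner_square_integrable[of M f g] by simp

lemma integral_norm_square_vec:
  fixes f :: "'a \<Rightarrow> real^'d"
  assumes "\<And>i. integrable M (\<lambda>x. (f x $ i)\<^sup>2)"
  shows "integrable M (\<lambda>x. (norm (f x))\<^sup>2)"
    and "(\<integral>x. (norm (f x))\<^sup>2 \<partial>M) = (\<Sum>i\<in>UNIV. \<integral>x. (f x $ i)\<^sup>2 \<partial>M)"
proof -
  have norm_eq: "(\<lambda>x. (norm (f x))\<^sup>2) = (\<lambda>x. \<Sum>i\<in>UNIV. (f x $ i)\<^sup>2)"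
    by (simp add: norm_vec_def L2_set_def sum_nonneg)
  show "integrable M (\<lambda>x. (norm (f x))\<^sup>2)"
    unfolding norm_eq using assms by simp
  show "(\<integral>x. (norm (f x))\<^sup>2 \<partial>M) = (\<Sum>i\<in>UNIV. \<integral>x. (f x $ i)\<^sup>2 \<partial>M)"
    unfolding norm_eq using assms by (simp add: Bochner_Integration.integral_sum)
qed

definition Usq :: "'a measure \<Rightarrow> nat \<Rightarrow> (nat \<Rightarrow> 'a \<Rightarrow> real^'m) \<Rightarrow> real" where
  "Usq M N u = (\<integral>x. (\<Sum>k<N. (norm (u k x))\<^sup>2) \<partial>M)"

lemma Unorm_eq_sqrt_Usq: "Unorm M N u = sqrt (Usq M N u)"
  by (simp add: Unorm_def Usq_def)

lemma Usq_nonneg: "0 \<le> Usq M N u"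
  unfolding Usq_def by (rule integral_nonneg_AE) (auto intro!: sum_nonneg)

lemma Usq_eq_sum:
  assumes "\<forall>k<N. square_integrable M (u k)"
  shows "Usq M N u = (\<Sum>k<N. \<integral>x. (norm (u k x))\<^sup>2 \<partial>M)"
  unfolding Usq_def using assms
  by (intro Bochner_Integration.integral_sum) (auto simp: square_integrable_def)

lemma integral_norm_square_le_Usq:
  assumes "\<forall>k<N. square_integrable M (u k)" and "k < N"
  shows "(\<integral>x. (norm (u k x))\<^sup>2 \<partial>M) \<le> Usq M N u"
  unfolding Usq_eq_sum[OF assms(1)] using assms(2)
  by (intro member_le_sum) auto

section \<open>Conditional expectation in \<open>L\<^sup>2\<close>\<close>

lemma square_integrable_by_truncation:
  fixes Z :: "'a \<Rightarrow> real"
  assumes Z: "integrable M Z"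
    and truncated: "\<And>n::nat. (\<integral>x. (if \<bar>Z x\<bar> \<le> n then Z x else 0)\<^sup>2 \<partial>M) \<le> c"
  shows "integrable M (\<lambda>x. (Z x)\<^sup>2)" and "(\<integral>x. (Z x)\<^sup>2 \<partial>M) \<le> c"
proof -
  define Zn where "Zn n x = (if \<bar>Z x\<bar> \<le> real n then Z x else 0)" for n x
  have [measurable]: "Z \<in> borel_measurable M" using Z by auto
  have Zn_integrable: "integrable M (\<lambda>x. (Zn n x)\<^sup>2)" for n
  proof (rule Bochner_Integration.integrable_bound)
    show "integrable M (\<lambda>x. real n * \<bar>Z x\<bar>)" using Z by simp
    show "AE x in M. norm ((Zn n x)\<^sup>2) \<le> norm (real n * \<bar>Z x\<bar>)"
    proof (intro AE_I2)
      fix x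
      have "(Zn n x)\<^sup>2 \<le> real n * \<bar>Z x\<bar>"
      proof (cases "\<bar>Z x\<bar> \<le> real n")
        case True
        then have "\<bar>Z x\<bar> * \<bar>Z x\<bar> \<le> real n * \<bar>Z x\<bar>" by (intro mult_right_mono) auto
        then show ?thesis using True by (simp add: Zn_def power2_eq_square abs_mult_self_eq)
      qed (simp add: Zn_def)
      then show "norm ((Zn n x)\<^sup>2) \<le> norm (real n * \<bar>Z x\<bar>)" by simp
    qed
  qed (simp add: Zn_def)
  have mono: "mono (\<lambda>n. (Zn n x)\<^sup>2)" for x
    by (rule monoI) (auto simp: Zn_def)
  have lim: "(\<lambda>n. (Zn n x)\<^sup>2) \<longlonglongrightarrow> (Z x)\<^sup>2" for x
  proof (rule tendsto_eventually)
    obtain m :: nat where "\<bar>Z x\<bar> \<le> real m" using real_arch_simple by blast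
    then show "\<forall>\<^sub>F n in sequentially. (Zn n x)\<^sup>2 = (Z x)\<^sup>2"
      unfolding eventually_sequentially Zn_def by (intro exI[of _ m]) auto
  qed
  have "incseq (\<lambda>n. \<integral>x. (Zn n x)\<^sup>2 \<partial>M)"
    using mono by (intro incseq_SucI integral_mono[OF Zn_integrable Zn_integrable]) (simp add: mono_def)
  moreover have "bdd_above (range (\<lambda>n. \<integral>x. (Zn n x)\<^sup>2 \<partial>M))"
    using truncated by (intro bdd_aboveI2[where M=c]) (simp add: Zn_def)
  ultimately have L: "(\<lambda>n. \<integral>x. (Zn n x)\<^sup>2 \<partial>M) \<longlonglongrightarrow> (SUP n. \<integral>x. (Zn n x)\<^sup>2 \<partial>M)"
    by (intro LIMSEQ_incseq_SUP)
  show "integrable M (\<lambda>x. (Z x)\<^sup>2)"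
    by (rule integrable_monotone_convergence[OF Zn_integrable _ _ L]) (use mono lim in auto)
  have "(\<integral>x. (Z x)\<^sup>2 \<partial>M) = (SUP n. \<integral>x. (Zn n x)\<^sup>2 \<partial>M)"
    by (rule integral_monotone_convergence[OF Zn_integrable _ _ L]) (use mono lim in auto)
  also have "\<dots> \<le> c"
    using truncated by (intro cSUP_least) (auto simp: Zn_def)
  finally show "(\<integral>x. (Z x)\<^sup>2 \<partial>M) \<le> c" .
qed

lemma vcexp_nth [simp]: "vcexp M F f x $ i = real_cond_exp M F (\<lambda>z. f z $ i) x"
  by (simp add: vcexp_def)

lemma borel_measurable_vcexp [measurable]: "vcexp M F f \<in> borel_measurable M"
  unfolding vcexp_def by (rule borel_measurable_vec_lambda) simp

context sigma_finite_subalgebra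
begin

lemma integral_mult_real_cond_exp_weighted_le:
  fixes \<zeta> w y :: "'a \<Rightarrow> real"
  assumes [measurable]: "\<zeta> \<in> borel_measurable F" "w \<in> borel_measurable M" "y \<in> borel_measurable M"
    and \<zeta>_bounded: "\<And>x. \<bar>\<zeta> x\<bar> \<le> b"
    and w: "integrable M (\<lambda>x. (w x)\<^sup>2)" "AE x in M. real_cond_exp M F (\<lambda>x. (w x)\<^sup>2) x = 1"
    and y: "integrable M (\<lambda>x. (y x)\<^sup>2)"
  shows "(\<integral>x. \<zeta> x * real_cond_exp M F (\<lambda>x. w x * y x) x \<partial>M)
           \<le> ((\<integral>x. (\<zeta> x)\<^sup>2 \<partial>M) + (\<integral>x. (y x)\<^sup>2 \<partial>M)) / 2"
proof -
  have [measurable]: "\<zeta> \<in> borel_measurable M" by (rule measurable_from_subalg[OF subalg]) simp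
  have b: "0 \<le> b" using \<zeta>_bounded abs_ge_zero order_trans by blast
  have wy: "integrable M (\<lambda>x. w x * y x)"
    using w(1) y by (intro integrable_mult_square_integrable) (simp_all add: square_integrable_def)
  have \<zeta>wy: "integrable M (\<lambda>x. \<zeta> x * (w x * y x))"
  proof (rule Bochner_Integration.integrable_bound)
    show "integrable M (\<lambda>x. b * (w x * y x))" using wy by simp
    show "AE x in M. norm (\<zeta> x * (w x * y x)) \<le> norm (b * (w x * y x))"
      using \<zeta>_bounded b by (intro AE_I2) (simp add: abs_mult mult_right_mono)
  qed simp
  have \<zeta>w: "integrable M (\<lambda>x. (\<zeta> x)\<^sup>2 * (w x)\<^sup>2)"
  proof (rule Bochner_Integration.integrable_bound)
    show "integrable M (\<lambda>x. b\<^sup>2 * (w x)\<^sup>2)" using w(1) by simp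
    show "AE x in M. norm ((\<zeta> x)\<^sup>2 * (w x)\<^sup>2) \<le> norm (b\<^sup>2 * (w x)\<^sup>2)"
    proof (intro AE_I2)
      fix x
      have "(\<zeta> x)\<^sup>2 \<le> b\<^sup>2" using power_mono[OF \<zeta>_bounded abs_ge_zero, of x 2] by simp
      then show "norm ((\<zeta> x)\<^sup>2 * (w x)\<^sup>2) \<le> norm (b\<^sup>2 * (w x)\<^sup>2)"
        by (simp add: mult_right_mono)
    qed
  qed simp
  have "(\<integral>x. \<zeta> x * real_cond_exp M F (\<lambda>x. w x * y x) x \<partial>M) = (\<integral>x. \<zeta> x * (w x * y x) \<partial>M)"
    by (rule real_cond_exp_intg(2)[OF \<zeta>wy]) simp_all
  also have "\<dots> \<le> (\<integral>x. ((\<zeta> x)\<^sup>2 * (w x)\<^sup>2 + (y x)\<^sup>2) / 2 \<partial>M)"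
  proof (rule integral_mono[OF \<zeta>wy])
    show "integrable M (\<lambda>x. ((\<zeta> x)\<^sup>2 * (w x)\<^sup>2 + (y x)\<^sup>2) / 2)" using \<zeta>w y by simp
    show "\<zeta> x * (w x * y x) \<le> ((\<zeta> x)\<^sup>2 * (w x)\<^sup>2 + (y x)\<^sup>2) / 2" for x
      using sum_squares_bound[of "\<zeta> x * w x" "y x"] by (simp add: power_mult_distrib mult_ac)
  qed
  also have "\<dots> = ((\<integral>x. (\<zeta> x)\<^sup>2 * real_cond_exp M F (\<lambda>x. (w x)\<^sup>2) x \<partial>M) + (\<integral>x. (y x)\<^sup>2 \<partial>M)) / 2"
    using \<zeta>w y real_cond_exp_intg(2)[OF \<zeta>w] by simp
  also have "(\<integral>x. (\<zeta> x)\<^sup>2 * real_cond_exp M F (\<lambda>x. (w x)\<^sup>2) x \<partial>M) = (\<integral>x. (\<zeta> x)\<^sup>2 \<partial>M)"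
    using w(2) by (intro integral_cong_AE) auto
  finally show ?thesis .
qed

text \<open>Testing \<open>E[w y | F]\<close> against its own truncations \<open>\<zeta>\<close>, for which
  \<open>\<zeta> E[w y | F] = \<zeta>\<^sup>2\<close>, avoids having to know in advance that it is square integrable.\<close>

lemma real_cond_exp_weighted_square:
  fixes w y :: "'a \<Rightarrow> real"
  assumes [measurable]: "w \<in> borel_measurable M" "y \<in> borel_measurable M"
    and w: "integrable M (\<lambda>x. (w x)\<^sup>2)" "AE x in M. real_cond_exp M F (\<lambda>x. (w x)\<^sup>2) x = 1"
    and y: "integrable M (\<lambda>x. (y x)\<^sup>2)"
  shows "integrable M (\<lambda>x. (real_cond_exp M F (\<lambda>x. w x * y x) x)\<^sup>2)"
    and "(\<integral>x. (real_cond_exp M F (\<lambda>x. w x * y x) x)\<^sup>2 \<partial>M) \<le> (\<integral>x. (y x)\<^sup>2 \<partial>M)"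
proof -
  define Z where "Z = real_cond_exp M F (\<lambda>x. w x * y x)"
  have "integrable M (\<lambda>x. w x * y x)"
    using w(1) y by (intro integrable_mult_square_integrable) (simp_all add: square_integrable_def)
  then have "integrable M Z" unfolding Z_def by (rule real_cond_exp_int(1))
  moreover have "(\<integral>x. (if \<bar>Z x\<bar> \<le> n then Z x else 0)\<^sup>2 \<partial>M) \<le> (\<integral>x. (y x)\<^sup>2 \<partial>M)" for n :: nat
  proof -
    define \<zeta> where "\<zeta> x = (if \<bar>Z x\<bar> \<le> n then Z x else 0)" for x
    have [measurable]: "\<zeta> \<in> borel_measurable F" unfolding \<zeta>_def Z_def by measurable
    have "\<zeta> x * Z x = (\<zeta> x)\<^sup>2" for x by (simp add: \<zeta>_def power2_eq_square)
    then have "(\<integral>x. (\<zeta> x)\<^sup>2 \<partial>M) \<le> ((\<integral>x. (\<zeta> x)\<^sup>2 \<partial>M) + (\<integral>x. (y x)\<^sup>2 \<partial>M)) / 2"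
      using integral_mult_real_cond_exp_weighted_le[of \<zeta> w y n] w y
      by (simp add: Z_def \<zeta>_def)
    then show ?thesis unfolding \<zeta>_def by simp
  qed
  ultimately show "integrable M (\<lambda>x. (real_cond_exp M F (\<lambda>x. w x * y x) x)\<^sup>2)"
    and "(\<integral>x. (real_cond_exp M F (\<lambda>x. w x * y x) x)\<^sup>2 \<partial>M) \<le> (\<integral>x. (y x)\<^sup>2 \<partial>M)"
    unfolding Z_def by (rule square_integrable_by_truncation)+
qed

lemma vcexp_weighted_square:
  fixes f :: "'a \<Rightarrow> real^'d"
  assumes [measurable]: "w \<in> borel_measurable M"
    and w: "integrable M (\<lambda>x. (w x)\<^sup>2)" "AE x in M. real_cond_exp M F (\<lambda>x. (w x)\<^sup>2) x = 1"
    and f: "square_integrable M f"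
  shows "square_integrable M (vcexp M F (\<lambda>z. w z *\<^sub>R f z))"
    and "(\<integral>x. (norm (vcexp M F (\<lambda>z. w z *\<^sub>R f z) x))\<^sup>2 \<partial>M) \<le> (\<integral>x. (norm (f x))\<^sup>2 \<partial>M)"
proof -
  have fi: "square_integrable M (\<lambda>x. f x $ i)" for i
    by (rule square_integrable_component[OF f])
  have ci: "integrable M (\<lambda>x. (vcexp M F (\<lambda>z. w z *\<^sub>R f z) x $ i)\<^sup>2)"
    and cb: "(\<integral>x. (vcexp M F (\<lambda>z. w z *\<^sub>R f z) x $ i)\<^sup>2 \<partial>M) \<le> (\<integral>x. (f x $ i)\<^sup>2 \<partial>M)" for i
    using real_cond_exp_weighted_square[of w "\<lambda>x. f x $ i", OF _ _ w] fi
    by (auto simp: square_integrable_def)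
  show "square_integrable M (vcexp M F (\<lambda>z. w z *\<^sub>R f z))"
    using integral_norm_square_vec(1)[OF ci] by (simp add: square_integrable_def)
  have "(\<integral>x. (norm (vcexp M F (\<lambda>z. w z *\<^sub>R f z) x))\<^sup>2 \<partial>M)
      = (\<Sum>i\<in>UNIV. \<integral>x. (vcexp M F (\<lambda>z. w z *\<^sub>R f z) x $ i)\<^sup>2 \<partial>M)"
    by (rule integral_norm_square_vec(2)[OF ci])
  also have "\<dots> \<le> (\<Sum>i\<in>UNIV. \<integral>x. (f x $ i)\<^sup>2 \<partial>M)"
    by (rule sum_mono[OF cb])
  also have "\<dots> = (\<integral>x. (norm (f x))\<^sup>2 \<partial>M)"
    using fi by (intro integral_norm_square_vec(2)[symmetric]) (simp add: square_integrable_def)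
  finally show "(\<integral>x. (norm (vcexp M F (\<lambda>z. w z *\<^sub>R f z) x))\<^sup>2 \<partial>M) \<le> (\<integral>x. (norm (f x))\<^sup>2 \<partial>M)" .
qed

lemma vcexp_square:
  fixes f :: "'a \<Rightarrow> real^'d"
  assumes "finite_measure M" and f: "square_integrable M f"
  shows "square_integrable M (vcexp M F f)"
    and "(\<integral>x. (norm (vcexp M F f x))\<^sup>2 \<partial>M) \<le> (\<integral>x. (norm (f x))\<^sup>2 \<partial>M)"
proof -
  interpret finite_measure M by fact
  have "AE x in M. real_cond_exp M F (\<lambda>x. 1\<^sup>2) x = 1"
    using real_cond_exp_F_meas[of "\<lambda>x. 1"] by simp
  then show "square_integrable M (vcexp M F f)"
    and "(\<integral>x. (norm (vcexp M F f x))\<^sup>2 \<partial>M) \<le> (\<integral>x. (norm (f x))\<^sup>2 \<partial>M)"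
    using vcexp_weighted_square[of "\<lambda>_. 1", OF _ _ _ f] by simp_all
qed

lemma vcexp_lincomb_AE:
  fixes f g h :: "'a \<Rightarrow> real^'d"
  assumes ae: "AE x in M. f x = a *\<^sub>R g x + b *\<^sub>R h x"
    and [measurable]: "f \<in> borel_measurable M"
    and g: "\<And>i. integrable M (\<lambda>x. g x $ i)" and h: "\<And>i. integrable M (\<lambda>x. h x $ i)"
  shows "AE x in M. vcexp M F f x = a *\<^sub>R vcexp M F g x + b *\<^sub>R vcexp M F h x"
proof -
  have "AE x in M. \<forall>i. real_cond_exp M F (\<lambda>z. f z $ i) x
          = a * real_cond_exp M F (\<lambda>z. g z $ i) x + b * real_cond_exp M F (\<lambda>z. h z $ i) x"
  proof (rule eventually_all_finite)
    fix i
    have [measurable]: "(\<lambda>x. g x $ i) \<in> borel_measurable M" "(\<lambda>x. h x $ i) \<in> borel_measurable M"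
      using g h by auto
    have "AE x in M. real_cond_exp M F (\<lambda>z. f z $ i) x
        = real_cond_exp M F (\<lambda>z. a * g z $ i + b * h z $ i) x"
      using ae by (intro real_cond_exp_cong) auto
    moreover have "AE x in M. real_cond_exp M F (\<lambda>z. a * g z $ i + b * h z $ i) x
        = real_cond_exp M F (\<lambda>z. a * g z $ i) x + real_cond_exp M F (\<lambda>z. b * h z $ i) x"
      using g h by (intro real_cond_exp_add) auto
    moreover have "AE x in M. real_cond_exp M F (\<lambda>z. a * g z $ i) x = a * real_cond_exp M F (\<lambda>z. g z $ i) x"
      using g by (rule real_cond_exp_cmult)
    moreover have "AE x in M. real_cond_exp M F (\<lambda>z. b * h z $ i) x = b * real_cond_exp M F (\<lambda>z. h z $ i) x"
      using h by (rule real_cond_exp_cmult)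
    ultimately show "AE x in M. real_cond_exp M F (\<lambda>z. f z $ i) x
        = a * real_cond_exp M F (\<lambda>z. g z $ i) x + b * real_cond_exp M F (\<lambda>z. h z $ i) x"
      by eventually_elim simp
  qed
  then show ?thesis by eventually_elim (simp add: vec_eq_iff)
qed

end

section \<open>Quadratic cost forms\<close>

definition stage_cost :: "real^'n^'n \<Rightarrow> real^'n^'m \<Rightarrow> real^'m^'m
    \<Rightarrow> real^'n \<Rightarrow> real^'m \<Rightarrow> real^'n \<Rightarrow> real^'m \<Rightarrow> real" where
  "stage_cost Q S R y u \<eta> \<rho> =
     (Q *v y) \<bullet> y + 2 * ((S *v y) \<bullet> u) + (R *v u) \<bullet> u + 2 * (\<eta> \<bullet> y) + 2 * (\<rho> \<bullet> u)"

definition cost_form :: "real^'n^'n \<Rightarrow> (nat \<Rightarrow> real^'n^'n) \<Rightarrow> (nat \<Rightarrow> real^'n^'m)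
    \<Rightarrow> (nat \<Rightarrow> real^'m^'m) \<Rightarrow> nat \<Rightarrow> real^'n \<Rightarrow> (nat \<Rightarrow> real^'n) \<Rightarrow> (nat \<Rightarrow> real^'m)
    \<Rightarrow> (nat \<Rightarrow> real^'n) \<Rightarrow> (nat \<Rightarrow> real^'m) \<Rightarrow> real" where
  "cost_form G0 Q S R N y0 ybar u \<eta> \<rho> =
     (G0 *v y0) \<bullet> y0 + (\<Sum>k<N. stage_cost (Q k) (S k) (R k) (ybar k) (u k) (\<eta> k) (\<rho> k))"

lemma cost_form_cong:
  assumes "y0 = y0'" "\<And>k. k < N \<Longrightarrow> ybar k = ybar' k" "\<And>k. k < N \<Longrightarrow> u k = u' k"
    "\<And>k. k < N \<Longrightarrow> \<eta> k = \<eta>' k" "\<And>k. k < N \<Longrightarrow> \<rho> k = \<rho>' k"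
  shows "cost_form G0 Q S R N y0 ybar u \<eta> \<rho> = cost_form G0 Q S R N y0' ybar' u' \<eta>' \<rho>'"
  unfolding cost_form_def using assms by (intro arg_cong2[where f="(+)"] sum.cong) auto

lemma bilinear_convex_comb:
  fixes G :: "real^'p^'q"
  assumes "t + s = 1"
  shows "(G *v (t *\<^sub>R a + s *\<^sub>R b)) \<bullet> (t *\<^sub>R c + s *\<^sub>R d)
    = t * ((G *v a) \<bullet> c) + s * ((G *v b) \<bullet> d) - t * s * ((G *v (a - b)) \<bullet> (c - d))"
proof -
  have s: "s = 1 - t" using assms by simp
  show ?thesis unfolding s
    by (simp add: matrix_vector_right_distrib matrix_vector_mult_scaleR matrix_vector_mult_diff_distrib
        inner_add_left inner_add_right inner_diff_left inner_diff_right algebra_simps)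
qed

lemma stage_cost_convex_comb:
  assumes "t + s = 1"
  shows "stage_cost Q S R (t *\<^sub>R y + s *\<^sub>R y') (t *\<^sub>R u + s *\<^sub>R u') \<eta> \<rho>
    = t * stage_cost Q S R y u \<eta> \<rho> + s * stage_cost Q S R y' u' \<eta> \<rho>
      - t * s * stage_cost Q S R (y - y') (u - u') 0 0"
proof -
  have s: "s = 1 - t" using assms by simp
  show ?thesis
    unfolding stage_cost_def bilinear_convex_comb[OF assms] unfolding s
    by (simp add: inner_add_right inner_diff_right algebra_simps)
qed

lemma cost_form_convex_comb:
  assumes "t + s = 1"
  shows "cost_form G0 Q S R N (t *\<^sub>R a0 + s *\<^sub>R b0) (\<lambda>k. t *\<^sub>R a k + s *\<^sub>R b k)
      (\<lambda>k. t *\<^sub>R u k + s *\<^sub>R v k) \<eta> \<rho>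
    = t * cost_form G0 Q S R N a0 a u \<eta> \<rho> + s * cost_form G0 Q S R N b0 b v \<eta> \<rho>
      - t * s * cost_form G0 Q S R N (a0 - b0) (\<lambda>k. a k - b k) (\<lambda>k. u k - v k) (\<lambda>_. 0) (\<lambda>_. 0)"
proof -
  have "(\<Sum>k<N. stage_cost (Q k) (S k) (R k) (t *\<^sub>R a k + s *\<^sub>R b k) (t *\<^sub>R u k + s *\<^sub>R v k) (\<eta> k) (\<rho> k))
      = t * (\<Sum>k<N. stage_cost (Q k) (S k) (R k) (a k) (u k) (\<eta> k) (\<rho> k))
        + s * (\<Sum>k<N. stage_cost (Q k) (S k) (R k) (b k) (v k) (\<eta> k) (\<rho> k))
        - t * s * (\<Sum>k<N. stage_cost (Q k) (S k) (R k) (a k - b k) (u k - v k) 0 0)"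
    by (simp add: stage_cost_convex_comb[OF assms] sum.distrib sum_subtractf sum_distrib_left)
  then show ?thesis
    unfolding cost_form_def bilinear_convex_comb[OF assms] by (simp add: algebra_simps)
qed

lemma abs_inner_mat_vec_le:
  fixes G :: "real^'p^'q"
  assumes "norm (G *v x) \<le> K * norm x"
  shows "\<bar>(G *v x) \<bullet> y\<bar> \<le> K * norm x * norm y"
proof -
  have "\<bar>(G *v x) \<bullet> y\<bar> \<le> norm (G *v x) * norm y" by (rule Cauchy_Schwarz_ineq2)
  also have "\<dots> \<le> K * norm x * norm y" using assms by (simp add: mult_right_mono)
  finally show ?thesis .
qed

lemma abs_inner_le_scaled:
  assumes "1 \<le> K"
  shows "\<bar>x \<bullet> y\<bar> \<le> K * norm x * norm y"
proof -
  have "\<bar>x \<bullet> y\<bar> \<le> norm x * norm y" by (rule Cauchy_Schwarz_ineq2)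
  also have "\<dots> \<le> K * norm x * norm y"
    using mult_right_mono[OF assms, of "norm x * norm y"] by (simp add: mult.assoc)
  finally show ?thesis .
qed

lemma mult_le_weighted_squares:
  fixes K a b e :: real
  assumes "0 < e"
  shows "2 * (K * a * b) \<le> K\<^sup>2 / e * a\<^sup>2 + e * b\<^sup>2"
proof -
  have "0 \<le> (K * a - e * b)\<^sup>2 / e" using assms by simp
  also have "(K * a - e * b)\<^sup>2 / e = K\<^sup>2 / e * a\<^sup>2 + e * b\<^sup>2 - 2 * (K * a * b)"
    using assms by (simp add: power2_eq_square field_simps)
  finally show ?thesis by simp
qed

lemma quadratic_add_ge:
  fixes G :: "real^'n^'n"
  assumes e: "0 < e" and G: "\<And>x. norm (G *v x) \<le> K * norm x"
  shows "(G *v a) \<bullet> a + (G *v b) \<bullet> b - K\<^sup>2 / e * (norm a)\<^sup>2 - e * (norm b)\<^sup>2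
    \<le> (G *v (a + b)) \<bullet> (a + b)"
proof -
  have "(G *v (a + b)) \<bullet> (a + b) = (G *v a) \<bullet> a + (G *v b) \<bullet> b + (G *v a) \<bullet> b + (G *v b) \<bullet> a"
    by (simp add: matrix_vector_right_distrib inner_add_left inner_add_right)
  moreover have "\<bar>(G *v a) \<bullet> b\<bar> \<le> K * norm a * norm b" "\<bar>(G *v b) \<bullet> a\<bar> \<le> K * norm a * norm b"
    using abs_inner_mat_vec_le[OF G, of a b] abs_inner_mat_vec_le[OF G, of b a] by (simp_all add: mult_ac)
  moreover have "2 * (K * norm a * norm b) \<le> K\<^sup>2 / e * (norm a)\<^sup>2 + e * (norm b)\<^sup>2"
    by (rule mult_le_weighted_squares[OF e])
  ultimately show ?thesis by linarith
qed

text \<open>Splitting the argument into a data part \<open>(y, \<eta>, \<rho>)\<close> and a control part \<open>(y', u)\<close>,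
  all cross terms are absorbed by Young's inequality with weight \<open>e\<close> on the control side.\<close>

lemma stage_cost_add_ge:
  assumes e: "0 < e" and K: "1 \<le> K"
    and Q: "\<And>x. norm (Q *v x) \<le> K * norm x" and S: "\<And>x. norm (S *v x) \<le> K * norm x"
  shows "stage_cost Q S R y 0 \<eta> \<rho> + stage_cost Q S R y' u 0 0
      - K\<^sup>2 / e * (2 * (norm y)\<^sup>2 + (norm \<eta>)\<^sup>2 + (norm \<rho>)\<^sup>2) - e * (2 * (norm y')\<^sup>2 + 2 * (norm u)\<^sup>2)
    \<le> stage_cost Q S R (y + y') u \<eta> \<rho>"
proof -
  have "stage_cost Q S R (y + y') u \<eta> \<rho> = stage_cost Q S R y 0 \<eta> \<rho> + stage_cost Q S R y' u 0 0
      + (Q *v y) \<bullet> y' + (Q *v y') \<bullet> y + 2 * ((S *v y) \<bullet> u) + 2 * (\<eta> \<bullet> y') + 2 * (\<rho> \<bullet> u)"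
    by (simp add: stage_cost_def matrix_vector_right_distrib inner_add_left inner_add_right algebra_simps)
  moreover have "\<bar>(Q *v y) \<bullet> y'\<bar> \<le> K * norm y * norm y'" "\<bar>(Q *v y') \<bullet> y\<bar> \<le> K * norm y * norm y'"
    "\<bar>(S *v y) \<bullet> u\<bar> \<le> K * norm y * norm u"
    "\<bar>\<eta> \<bullet> y'\<bar> \<le> K * norm \<eta> * norm y'" "\<bar>\<rho> \<bullet> u\<bar> \<le> K * norm \<rho> * norm u"
    using abs_inner_mat_vec_le[OF Q, of y y'] abs_inner_mat_vec_le[OF Q, of y' y]
      abs_inner_mat_vec_le[OF S, of y u] abs_inner_le_scaled[OF K] by (simp_all add: mult_ac)
  moreover have "2 * (K * norm y * norm y') \<le> K\<^sup>2 / e * (norm y)\<^sup>2 + e * (norm y')\<^sup>2"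
    "2 * (K * norm y * norm u) \<le> K\<^sup>2 / e * (norm y)\<^sup>2 + e * (norm u)\<^sup>2"
    "2 * (K * norm \<eta> * norm y') \<le> K\<^sup>2 / e * (norm \<eta>)\<^sup>2 + e * (norm y')\<^sup>2"
    "2 * (K * norm \<rho> * norm u) \<le> K\<^sup>2 / e * (norm \<rho>)\<^sup>2 + e * (norm u)\<^sup>2"
    by (rule mult_le_weighted_squares[OF e])+
  ultimately show ?thesis by (simp add: algebra_simps)
qed

lemma cost_form_add_ge:
  assumes e: "0 < e" and K: "1 \<le> K"
    and G0: "\<And>x. norm (G0 *v x) \<le> K * norm x"
    and Q: "\<And>k x. k < N \<Longrightarrow> norm (Q k *v x) \<le> K * norm x"
    and S: "\<And>k x. k < N \<Longrightarrow> norm (S k *v x) \<le> K * norm x"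
  shows "cost_form G0 Q S R N a0 a (\<lambda>_. 0) \<eta> \<rho> + cost_form G0 Q S R N b0 b u (\<lambda>_. 0) (\<lambda>_. 0)
      - K\<^sup>2 / e * ((norm a0)\<^sup>2 + (\<Sum>k<N. 2 * (norm (a k))\<^sup>2 + (norm (\<eta> k))\<^sup>2 + (norm (\<rho> k))\<^sup>2))
      - e * ((norm b0)\<^sup>2 + (\<Sum>k<N. 2 * (norm (b k))\<^sup>2 + 2 * (norm (u k))\<^sup>2))
    \<le> cost_form G0 Q S R N (a0 + b0) (\<lambda>k. a k + b k) u \<eta> \<rho>"
proof -
  have "cost_form G0 Q S R N a0 a (\<lambda>_. 0) \<eta> \<rho> + cost_form G0 Q S R N b0 b u (\<lambda>_. 0) (\<lambda>_. 0)
      - K\<^sup>2 / e * ((norm a0)\<^sup>2 + (\<Sum>k<N. 2 * (norm (a k))\<^sup>2 + (norm (\<eta> k))\<^sup>2 + (norm (\<rho> k))\<^sup>2))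
      - e * ((norm b0)\<^sup>2 + (\<Sum>k<N. 2 * (norm (b k))\<^sup>2 + 2 * (norm (u k))\<^sup>2))
    = ((G0 *v a0) \<bullet> a0 + (G0 *v b0) \<bullet> b0 - K\<^sup>2 / e * (norm a0)\<^sup>2 - e * (norm b0)\<^sup>2)
      + (\<Sum>k<N. stage_cost (Q k) (S k) (R k) (a k) 0 (\<eta> k) (\<rho> k)
        + stage_cost (Q k) (S k) (R k) (b k) (u k) 0 0
        - K\<^sup>2 / e * (2 * (norm (a k))\<^sup>2 + (norm (\<eta> k))\<^sup>2 + (norm (\<rho> k))\<^sup>2)
        - e * (2 * (norm (b k))\<^sup>2 + 2 * (norm (u k))\<^sup>2))"
    by (simp add: cost_form_def sum.distrib sum_subtractf sum_distrib_left algebra_simps)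
  also have "\<dots> \<le> (G0 *v (a0 + b0)) \<bullet> (a0 + b0)
      + (\<Sum>k<N. stage_cost (Q k) (S k) (R k) (a k + b k) (u k) (\<eta> k) (\<rho> k))"
    using quadratic_add_ge[OF e G0] stage_cost_add_ge[OF e K Q S]
    by (intro add_mono sum_mono) simp_all
  also have "\<dots> = cost_form G0 Q S R N (a0 + b0) (\<lambda>k. a k + b k) u \<eta> \<rho>"
    by (simp add: cost_form_def)
  finally show ?thesis .
qed

lemma mat_vec_uniform_bound:
  fixes G :: "real^'n^'n" and Q :: "nat \<Rightarrow> real^'n^'n" and S :: "nat \<Rightarrow> real^'n^'m"
  obtains K where "1 \<le> K" "\<And>x. norm (G *v x) \<le> K * norm x"
    "\<And>k x. k < N \<Longrightarrow> norm (Q k *v x) \<le> K * norm x"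
    "\<And>k x. k < N \<Longrightarrow> norm (S k *v x) \<le> K * norm x"
proof -
  define K where "K = 1 + onorm ((*v) G) + (\<Sum>k<N. onorm ((*v) (Q k)) + onorm ((*v) (S k)))"
  have sum_ge: "onorm ((*v) (Q k)) + onorm ((*v) (S k)) \<le> (\<Sum>k<N. onorm ((*v) (Q k)) + onorm ((*v) (S k)))"
    if "k < N" for k
    using that by (intro member_le_sum[where f="\<lambda>k. onorm ((*v) (Q k)) + onorm ((*v) (S k))"])
      (simp_all add: add_nonneg_nonneg onorm_mat_vec_nonneg)
  have sum_nonneg: "0 \<le> (\<Sum>k<N. onorm ((*v) (Q k)) + onorm ((*v) (S k)))"
    by (intro sum_nonneg add_nonneg_nonneg onorm_mat_vec_nonneg)
  show ?thesis
  proof (rule that)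
    show "1 \<le> K" using onorm_mat_vec_nonneg[of G] sum_nonneg by (simp add: K_def)
    show "norm (G *v x) \<le> K * norm x" for x
      by (rule norm_mat_vec_le_of_onorm_le) (use sum_nonneg in \<open>simp add: K_def\<close>)
    show "norm (Q k *v x) \<le> K * norm x" "norm (S k *v x) \<le> K * norm x" if "k < N" for k x
      using sum_ge[OF that] onorm_mat_vec_nonneg[of G] onorm_mat_vec_nonneg[of "Q k"] onorm_mat_vec_nonneg[of "S k"]
      by (auto intro!: norm_mat_vec_le_of_onorm_le simp: K_def)
  qed
qed

section \<open>The controlled backward state equation\<close>

lemma subalgebra_sigma:
  assumes "G \<subseteq> sets M"
  shows "subalgebra M (sigma (space M) G)"
proof -
  have "G \<subseteq> Pow (space M)" using assms sets.sets_into_space by blast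
  then show ?thesis
    using sets.sigma_sets_subset[OF assms] by (simp add: subalgebra_def space_measure_of)
qed

locale lq_problem = prob_space M for M :: "'a measure" +
  fixes w :: "nat \<Rightarrow> 'a \<Rightarrow> real" and N :: nat
    and A :: "nat \<Rightarrow> real^'n^'n" and B :: "nat \<Rightarrow> real^'m^'n" and C :: "nat \<Rightarrow> real^'n^'n"
    and G0 :: "real^'n^'n" and Q :: "nat \<Rightarrow> real^'n^'n" and S :: "nat \<Rightarrow> real^'n^'m"
    and R :: "nat \<Rightarrow> real^'m^'m"
  assumes noise_measurable: "\<And>k. k < N \<Longrightarrow> w k \<in> borel_measurable M"
    and noise_square_integrable: "\<And>k. k < N \<Longrightarrow> integrable M (\<lambda>x. (w k x)\<^sup>2)"
    and noise_cond_variance: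
      "\<And>k. k < N \<Longrightarrow> AE x in M. real_cond_exp M (Fm M w k) (\<lambda>z. (w k z)\<^sup>2) x = 1"
begin

lemma subalgebra_Fm: "k \<le> N \<Longrightarrow> subalgebra M (Fm M w k)"
  using noise_measurable
  by (auto simp: Fm_def intro!: subalgebra_sigma measurable_sets)

lemma sigma_finite_subalgebra_Fm: "k \<le> N \<Longrightarrow> sigma_finite_subalgebra M (Fm M w k)"
  by (intro finite_measure_subalgebra_is_sigma_finite)
    (simp add: finite_measure_subalgebra_def finite_measure_subalgebra_axioms_def
      subalgebra_Fm finite_measure_axioms)

text \<open>\<open>Y q \<xi> u j\<close> is the state \<open>y\<^sub>N\<^sub>-\<^sub>j\<close>, and \<open>Ybar q \<xi> u k\<close> is
  \<open>E\<^sub>k\<^sub>-\<^sub>1[y\<^sub>k\<^sub>+\<^sub>1]\<close>, the argument of the running cost at time \<open>k\<close>.\<close>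

abbreviation Y :: "(nat \<Rightarrow> 'a \<Rightarrow> real^'n) \<Rightarrow> ('a \<Rightarrow> real^'n) \<Rightarrow> (nat \<Rightarrow> 'a \<Rightarrow> real^'m)
    \<Rightarrow> nat \<Rightarrow> 'a \<Rightarrow> real^'n" where
  "Y q \<xi> u j \<equiv> ybw M w N A B C q \<xi> u j"

abbreviation Ybar :: "(nat \<Rightarrow> 'a \<Rightarrow> real^'n) \<Rightarrow> ('a \<Rightarrow> real^'n) \<Rightarrow> (nat \<Rightarrow> 'a \<Rightarrow> real^'m)
    \<Rightarrow> nat \<Rightarrow> 'a \<Rightarrow> real^'n" where
  "Ybar q \<xi> u k \<equiv> vcexp M (Fm M w k) (Y q \<xi> u (N - Suc k))"

lemma square_integrable_Y:
  assumes "square_integrable M \<xi>" "\<forall>k<N. square_integrable M (q k)"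
    and "\<forall>k<N. square_integrable M (u k)"
  shows "j \<le> N \<Longrightarrow> square_integrable M (Y q \<xi> u j)"
proof (induction j)
  case 0
  then show ?case using assms by simp
next
  case (Suc j)
  define k where "k = N - Suc j"
  have k: "k < N" using Suc.prems by (simp add: k_def)
  interpret F: sigma_finite_subalgebra M "Fm M w k" by (rule sigma_finite_subalgebra_Fm) (use k in simp)
  have "square_integrable M (Y q \<xi> u j)" using Suc by simp
  then have "square_integrable M (vcexp M (Fm M w k) (Y q \<xi> u j))"
    and "square_integrable M (vcexp M (Fm M w k) (\<lambda>z. w k z *\<^sub>R Y q \<xi> u j z))"
    using k by (auto intro: F.vcexp_square finite_measure_axioms F.vcexp_weighted_square
      noise_measurable noise_square_integrable noise_cond_variance)
  then show ?case
    using assms k by (simp add: k_def[symmetric] square_integrable_add square_integrable_mat_vec)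
qed

lemma square_integrable_Ybar:
  assumes "square_integrable M \<xi>" "\<forall>k<N. square_integrable M (q k)"
    and "\<forall>k<N. square_integrable M (u k)" and "k < N"
  shows "square_integrable M (Ybar q \<xi> u k)"
    and "(\<integral>x. (norm (Ybar q \<xi> u k x))\<^sup>2 \<partial>M) \<le> (\<integral>x. (norm (Y q \<xi> u (N - Suc k) x))\<^sup>2 \<partial>M)"
proof -
  interpret F: sigma_finite_subalgebra M "Fm M w k"
    by (rule sigma_finite_subalgebra_Fm) (use assms in simp)
  have "square_integrable M (Y q \<xi> u (N - Suc k))"
    using assms by (intro square_integrable_Y) auto
  then show "square_integrable M (Ybar q \<xi> u k)"
    and "(\<integral>x. (norm (Ybar q \<xi> u k x))\<^sup>2 \<partial>M) \<le> (\<integral>x. (norm (Y q \<xi> u (N - Suc k) x))\<^sup>2 \<partial>M)"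
    by (rule F.vcexp_square[OF finite_measure_axioms])+
qed

lemma Y_lincomb_AE:
  assumes d1: "square_integrable M \<xi>1" "\<forall>k<N. square_integrable M (q1 k)"
      "\<forall>k<N. square_integrable M (u1 k)"
    and d2: "square_integrable M \<xi>2" "\<forall>k<N. square_integrable M (q2 k)"
      "\<forall>k<N. square_integrable M (u2 k)"
    and \<xi>: "\<xi> = (\<lambda>x. \<alpha> *\<^sub>R \<xi>1 x + \<beta> *\<^sub>R \<xi>2 x)"
    and q: "\<forall>k<N. q k = (\<lambda>x. \<alpha> *\<^sub>R q1 k x + \<beta> *\<^sub>R q2 k x)"
    and u: "\<forall>k<N. u k = (\<lambda>x. \<alpha> *\<^sub>R u1 k x + \<beta> *\<^sub>R u2 k x)"
  shows "j \<le> N \<Longrightarrow> AE x in M. Y q \<xi> u j x = \<alpha> *\<^sub>R Y q1 \<xi>1 u1 j x + \<beta> *\<^sub>R Y q2 \<xi>2 u2 j x"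
proof (induction j)
  case 0
  then show ?case using \<xi> by simp
next
  case (Suc j)
  define k where "k = N - Suc j"
  have k: "k < N" using Suc.prems by (simp add: k_def)
  interpret F: sigma_finite_subalgebra M "Fm M w k"
    by (rule sigma_finite_subalgebra_Fm) (use k in simp)
  have "square_integrable M \<xi>" "\<forall>k<N. square_integrable M (q k)" "\<forall>k<N. square_integrable M (u k)"
    using \<xi> q u d1 d2 by (auto intro: square_integrable_lincomb)
  then have Y: "square_integrable M (Y q \<xi> u j)"
    and Y1: "square_integrable M (Y q1 \<xi>1 u1 j)" and Y2: "square_integrable M (Y q2 \<xi>2 u2 j)"
    using Suc.prems d1 d2 by (auto intro: square_integrable_Y)
  have [measurable]: "w k \<in> borel_measurable M" "Y q \<xi> u j \<in> borel_measurable M"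
    using Y k noise_measurable by (auto simp: square_integrable_def)
  have IH: "AE x in M. Y q \<xi> u j x = \<alpha> *\<^sub>R Y q1 \<xi>1 u1 j x + \<beta> *\<^sub>R Y q2 \<xi>2 u2 j x"
    using Suc by simp
  have "AE x in M. vcexp M (Fm M w k) (Y q \<xi> u j) x
      = \<alpha> *\<^sub>R vcexp M (Fm M w k) (Y q1 \<xi>1 u1 j) x + \<beta> *\<^sub>R vcexp M (Fm M w k) (Y q2 \<xi>2 u2 j) x"
    using Y1 Y2
    by (intro F.vcexp_lincomb_AE[OF IH]) (auto intro: integrable_square_integrable square_integrable_component)
  moreover have "AE x in M. vcexp M (Fm M w k) (\<lambda>z. w k z *\<^sub>R Y q \<xi> u j z) x
      = \<alpha> *\<^sub>R vcexp M (Fm M w k) (\<lambda>z. w k z *\<^sub>R Y q1 \<xi>1 u1 j z) x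
        + \<beta> *\<^sub>R vcexp M (Fm M w k) (\<lambda>z. w k z *\<^sub>R Y q2 \<xi>2 u2 j z) x"
  proof (rule F.vcexp_lincomb_AE)
    show "AE x in M. w k x *\<^sub>R Y q \<xi> u j x
        = \<alpha> *\<^sub>R (w k x *\<^sub>R Y q1 \<xi>1 u1 j x) + \<beta> *\<^sub>R (w k x *\<^sub>R Y q2 \<xi>2 u2 j x)"
      using IH by eventually_elim (simp add: algebra_simps)
    have "square_integrable M (w k)"
      using k noise_measurable noise_square_integrable by (simp add: square_integrable_def)
    then show "integrable M (\<lambda>x. (w k x *\<^sub>R Y q1 \<xi>1 u1 j x) $ i)"
      and "integrable M (\<lambda>x. (w k x *\<^sub>R Y q2 \<xi>2 u2 j x) $ i)" for i
      using Y1 Y2 by (auto intro: integrable_mult_square_integrable square_integrable_component)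
  qed simp
  ultimately show ?case
    by eventually_elim (use q u k in \<open>simp add: k_def[symmetric] algebra_simps\<close>)
qed

lemma state_lincomb_AE:
  assumes d1: "square_integrable M \<xi>1" "\<forall>k<N. square_integrable M (q1 k)"
      "\<forall>k<N. square_integrable M (u1 k)"
    and d2: "square_integrable M \<xi>2" "\<forall>k<N. square_integrable M (q2 k)"
      "\<forall>k<N. square_integrable M (u2 k)"
    and lincomb: "\<xi> = (\<lambda>x. \<alpha> *\<^sub>R \<xi>1 x + \<beta> *\<^sub>R \<xi>2 x)"
      "\<forall>k<N. q k = (\<lambda>x. \<alpha> *\<^sub>R q1 k x + \<beta> *\<^sub>R q2 k x)"
      "\<forall>k<N. u k = (\<lambda>x. \<alpha> *\<^sub>R u1 k x + \<beta> *\<^sub>R u2 k x)"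
  shows "AE x in M. Y q \<xi> u N x = \<alpha> *\<^sub>R Y q1 \<xi>1 u1 N x + \<beta> *\<^sub>R Y q2 \<xi>2 u2 N x \<and>
    (\<forall>k\<in>{..<N}. Ybar q \<xi> u k x = \<alpha> *\<^sub>R Ybar q1 \<xi>1 u1 k x + \<beta> *\<^sub>R Ybar q2 \<xi>2 u2 k x)"
proof (rule AE_conjI)
  show "AE x in M. Y q \<xi> u N x = \<alpha> *\<^sub>R Y q1 \<xi>1 u1 N x + \<beta> *\<^sub>R Y q2 \<xi>2 u2 N x"
    by (rule Y_lincomb_AE[OF d1 d2 lincomb]) simp
  show "AE x in M. \<forall>k\<in>{..<N}. Ybar q \<xi> u k x = \<alpha> *\<^sub>R Ybar q1 \<xi>1 u1 k x + \<beta> *\<^sub>R Ybar q2 \<xi>2 u2 k x"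
  proof (intro AE_finite_allI, simp)
    fix k assume "k \<in> {..<N}"
    then have k: "k < N" by simp
    interpret F: sigma_finite_subalgebra M "Fm M w k"
      by (rule sigma_finite_subalgebra_Fm) (use k in simp)
    have "square_integrable M \<xi>" "\<forall>k<N. square_integrable M (q k)" "\<forall>k<N. square_integrable M (u k)"
      using lincomb d1 d2 by (auto intro: square_integrable_lincomb)
    then have "square_integrable M (Y q \<xi> u (N - Suc k))"
      and Y1: "square_integrable M (Y q1 \<xi>1 u1 (N - Suc k))"
      and Y2: "square_integrable M (Y q2 \<xi>2 u2 (N - Suc k))"
      using d1 d2 by (auto intro: square_integrable_Y)
    then have [measurable]: "Y q \<xi> u (N - Suc k) \<in> borel_measurable M"
      by (simp add: square_integrable_def)
    show "AE x in M. Ybar q \<xi> u k x = \<alpha> *\<^sub>R Ybar q1 \<xi>1 u1 k x + \<beta> *\<^sub>R Ybar q2 \<xi>2 u2 k x"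
      using Y1 Y2
      by (intro F.vcexp_lincomb_AE Y_lincomb_AE[OF d1 d2 lincomb])
        (auto intro: integrable_square_integrable square_integrable_component)
  qed
qed

lemma Y_homogeneous_Suc_le:
  assumes u: "\<forall>k<N. square_integrable M (u k)" and j: "j < N"
  defines "k \<equiv> N - Suc j"
  shows "(\<integral>x. (norm (Y (\<lambda>_ _. 0) (\<lambda>_. 0) u (Suc j) x))\<^sup>2 \<partial>M)
    \<le> 4 * ((onorm ((*v) (A k)))\<^sup>2 + (onorm ((*v) (B k)))\<^sup>2 + (onorm ((*v) (C k)))\<^sup>2)
        * ((\<integral>x. (norm (Y (\<lambda>_ _. 0) (\<lambda>_. 0) u j x))\<^sup>2 \<partial>M) + (\<integral>x. (norm (u k x))\<^sup>2 \<partial>M))"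
proof -
  have k: "k < N" using j by (simp add: k_def)
  interpret F: sigma_finite_subalgebra M "Fm M w k"
    by (rule sigma_finite_subalgebra_Fm) (use k in simp)
  define y where "y = Y (\<lambda>_ _. 0) (\<lambda>_. 0) u j"
  define a where "a = vcexp M (Fm M w k) y"
  define c where "c = vcexp M (Fm M w k) (\<lambda>z. w k z *\<^sub>R y z)"
  define KA where "KA = (onorm ((*v) (A k)))\<^sup>2"
  define KB where "KB = (onorm ((*v) (B k)))\<^sup>2"
  define KC where "KC = (onorm ((*v) (C k)))\<^sup>2"
  have y: "square_integrable M y"
    unfolding y_def using u j by (intro square_integrable_Y) auto
  have a: "square_integrable M a" "(\<integral>x. (norm (a x))\<^sup>2 \<partial>M) \<le> (\<integral>x. (norm (y x))\<^sup>2 \<partial>M)"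
    unfolding a_def by (rule F.vcexp_square[OF finite_measure_axioms y])+
  have c: "square_integrable M c" "(\<integral>x. (norm (c x))\<^sup>2 \<partial>M) \<le> (\<integral>x. (norm (y x))\<^sup>2 \<partial>M)"
    unfolding c_def using F.vcexp_weighted_square[OF noise_measurable[OF k]
      noise_square_integrable[OF k] noise_cond_variance[OF k] y] by auto
  have uk: "square_integrable M (u k)" using u k by simp
  have "Y (\<lambda>_ _. 0) (\<lambda>_. 0) u (Suc j) = (\<lambda>x. A k *v a x + B k *v u k x + C k *v c x)"
    by (simp add: a_def c_def y_def k_def)
  then have "(\<integral>x. (norm (Y (\<lambda>_ _. 0) (\<lambda>_. 0) u (Suc j) x))\<^sup>2 \<partial>M)
      \<le> (\<integral>x. 4 * (KA * (norm (a x))\<^sup>2 + KB * (norm (u k x))\<^sup>2 + KC * (norm (c x))\<^sup>2) \<partial>M)"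
  proof (simp only:, intro integral_mono)
    have "square_integrable M (\<lambda>x. A k *v a x + B k *v u k x + C k *v c x)"
      using a(1) c(1) uk by (intro square_integrable_add square_integrable_mat_vec)
    then show "integrable M (\<lambda>x. (norm (A k *v a x + B k *v u k x + C k *v c x))\<^sup>2)"
      by (simp add: square_integrable_def)
    show "integrable M (\<lambda>x. 4 * (KA * (norm (a x))\<^sup>2 + KB * (norm (u k x))\<^sup>2 + KC * (norm (c x))\<^sup>2))"
      using a(1) c(1) uk by (simp add: square_integrable_def)
    show "(norm (A k *v a x + B k *v u k x + C k *v c x))\<^sup>2
        \<le> 4 * (KA * (norm (a x))\<^sup>2 + KB * (norm (u k x))\<^sup>2 + KC * (norm (c x))\<^sup>2)" for x
      unfolding KA_def KB_def KC_def by (rule norm_mat_vec_sum3_square_le)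
  qed
  also have "\<dots> = 4 * (KA * (\<integral>x. (norm (a x))\<^sup>2 \<partial>M) + KB * (\<integral>x. (norm (u k x))\<^sup>2 \<partial>M)
      + KC * (\<integral>x. (norm (c x))\<^sup>2 \<partial>M))"
    using a(1) c(1) uk by (simp add: square_integrable_def)
  also have "\<dots> \<le> 4 * (KA * (\<integral>x. (norm (y x))\<^sup>2 \<partial>M) + KB * (\<integral>x. (norm (u k x))\<^sup>2 \<partial>M)
      + KC * (\<integral>x. (norm (y x))\<^sup>2 \<partial>M))"
    using a(2) c(2) by (intro mult_left_mono add_mono) (simp_all add: KA_def KB_def KC_def)
  also have "\<dots> \<le> 4 * (KA + KB + KC) * ((\<integral>x. (norm (y x))\<^sup>2 \<partial>M) + (\<integral>x. (norm (u k x))\<^sup>2 \<partial>M))"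
    by (simp add: algebra_simps KA_def KB_def KC_def integral_nonneg_AE)
  finally show ?thesis unfolding KA_def KB_def KC_def y_def .
qed

lemma Y_homogeneous_square_integral_le:
  "\<exists>D\<ge>0. \<forall>u :: nat \<Rightarrow> 'a \<Rightarrow> real^'m. (\<forall>k<N. square_integrable M (u k)) \<longrightarrow>
    (\<forall>j\<le>N. (\<integral>x. (norm (Y (\<lambda>_ _. 0) (\<lambda>_. 0) u j x))\<^sup>2 \<partial>M) \<le> D * Usq M N u)"
proof -
  define K where "K j = 4 * ((onorm ((*v) (A (N - Suc j))))\<^sup>2 + (onorm ((*v) (B (N - Suc j))))\<^sup>2
    + (onorm ((*v) (C (N - Suc j))))\<^sup>2)" for j
  have K: "0 \<le> K j" for j by (simp add: K_def)
  have "\<exists>D\<ge>0. \<forall>u :: nat \<Rightarrow> 'a \<Rightarrow> real^'m. (\<forall>k<N. square_integrable M (u k)) \<longrightarrow>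
      (\<forall>i\<le>j. (\<integral>x. (norm (Y (\<lambda>_ _. 0) (\<lambda>_. 0) u i x))\<^sup>2 \<partial>M) \<le> D * Usq M N u)"
    if "j \<le> N" for j
    using that
  proof (induction j)
    case 0
    show ?case by (intro exI[of _ 0]) simp
  next
    case (Suc j)
    then obtain D where D: "0 \<le> D" "\<And>(u :: nat \<Rightarrow> 'a \<Rightarrow> real^'m) i. \<forall>k<N. square_integrable M (u k) \<Longrightarrow> i \<le> j \<Longrightarrow>
        (\<integral>x. (norm (Y (\<lambda>_ _. 0) (\<lambda>_. 0) u i x))\<^sup>2 \<partial>M) \<le> D * Usq M N u"
      by auto
    show ?case
    proof (intro exI[of _ "D + K j * (D + 1)"] conjI allI impI)
      show "0 \<le> D + K j * (D + 1)" using D(1) K by simp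
      fix u :: "nat \<Rightarrow> 'a \<Rightarrow> real^'m" and i
      assume u: "\<forall>k<N. square_integrable M (u k)" and i: "i \<le> Suc j"
      have le_D': "D * Usq M N u \<le> (D + K j * (D + 1)) * Usq M N u"
        using D(1) K Usq_nonneg by (intro mult_right_mono) simp_all
      have j: "j < N" using Suc.prems by simp
      have "(\<integral>x. (norm (Y (\<lambda>_ _. 0) (\<lambda>_. 0) u (Suc j) x))\<^sup>2 \<partial>M)
          \<le> K j * ((\<integral>x. (norm (Y (\<lambda>_ _. 0) (\<lambda>_. 0) u j x))\<^sup>2 \<partial>M) + (\<integral>x. (norm (u (N - Suc j) x))\<^sup>2 \<partial>M))"
        using Y_homogeneous_Suc_le[OF u j] by (simp add: K_def)
      also have "\<dots> \<le> K j * (D * Usq M N u + Usq M N u)"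
        using D(2)[OF u order_refl] integral_norm_square_le_Usq[OF u, of "N - Suc j"] j K
        by (intro mult_left_mono add_mono) auto
      finally have step: "(\<integral>x. (norm (Y (\<lambda>_ _. 0) (\<lambda>_. 0) u (Suc j) x))\<^sup>2 \<partial>M)
          \<le> K j * (D * Usq M N u + Usq M N u)" .
      consider "i \<le> j" | "i = Suc j" using i by linarith
      then show "(\<integral>x. (norm (Y (\<lambda>_ _. 0) (\<lambda>_. 0) u i x))\<^sup>2 \<partial>M) \<le> (D + K j * (D + 1)) * Usq M N u"
      proof cases
        case 1
        then show ?thesis using D(2)[OF u] le_D' by (meson order_trans)
      next
        case 2
        have "0 \<le> D * Usq M N u" by (rule mult_nonneg_nonneg[OF D(1) Usq_nonneg])
        then show ?thesis
          using step unfolding 2 by (simp add: algebra_simps del: ybw.simps)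
      qed
    qed
  qed
  then show ?thesis by simp
qed

section \<open>The cost functional\<close>

lemma square_integrable_L2F:
  assumes "h \<in> L2F M w N" "k < N"
  shows "square_integrable M (h k)"
proof -
  have "subalgebra M (Fm M w k)" using assms by (intro subalgebra_Fm) simp
  moreover have "h k \<in> borel_measurable (Fm M w k)" using assms by (simp add: L2F_def)
  ultimately have "h k \<in> borel_measurable M" by (rule measurable_from_subalg)
  then show ?thesis using assms by (simp add: L2F_def square_integrable_def)
qed

lemma L2F_lincomb:
  assumes "u \<in> L2F M w N" "v \<in> L2F M w N"
  shows "(\<lambda>k x. a *\<^sub>R u k x + b *\<^sub>R v k x) \<in> L2F M w N"
  unfolding L2F_def
proof (intro CollectI allI impI conjI)
  fix k assume k: "k < N"
  have [measurable]: "u k \<in> borel_measurable (Fm M w k)" "v k \<in> borel_measurable (Fm M w k)"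
    using assms k by (auto simp: L2F_def)
  show "(\<lambda>x. a *\<^sub>R u k x + b *\<^sub>R v k x) \<in> borel_measurable (Fm M w k)" by measurable
  show "integrable M (\<lambda>x. (norm (a *\<^sub>R u k x + b *\<^sub>R v k x))\<^sup>2)"
    using square_integrable_lincomb[OF square_integrable_L2F[OF assms(1) k] square_integrable_L2F[OF assms(2) k]]
    by (simp add: square_integrable_def)
qed

abbreviation J :: "(nat \<Rightarrow> 'a \<Rightarrow> real^'n) \<Rightarrow> ('a \<Rightarrow> real^'n) \<Rightarrow> (nat \<Rightarrow> 'a \<Rightarrow> real^'n)
    \<Rightarrow> (nat \<Rightarrow> 'a \<Rightarrow> real^'m) \<Rightarrow> (nat \<Rightarrow> 'a \<Rightarrow> real^'m) \<Rightarrow> real" where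
  "J q \<xi> \<eta> \<rho> u \<equiv> cost M w N A B C q G0 Q S R \<eta> \<rho> \<xi> u"

abbreviation J0 :: "(nat \<Rightarrow> 'a \<Rightarrow> real^'m) \<Rightarrow> real" where
  "J0 u \<equiv> J (\<lambda>_ _. 0) (\<lambda>_. 0) (\<lambda>_ _. 0) (\<lambda>_ _. 0) u"

definition cost_integrand :: "(nat \<Rightarrow> 'a \<Rightarrow> real^'n) \<Rightarrow> ('a \<Rightarrow> real^'n) \<Rightarrow> (nat \<Rightarrow> 'a \<Rightarrow> real^'n)
    \<Rightarrow> (nat \<Rightarrow> 'a \<Rightarrow> real^'m) \<Rightarrow> (nat \<Rightarrow> 'a \<Rightarrow> real^'m) \<Rightarrow> 'a \<Rightarrow> real" where
  "cost_integrand q \<xi> \<eta> \<rho> u x = cost_form G0 Q S R N (Y q \<xi> u N x) (\<lambda>k. Ybar q \<xi> u k x)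
     (\<lambda>k. u k x) (\<lambda>k. \<eta> k x) (\<lambda>k. \<rho> k x)"

lemma cost_eq_integral: "J q \<xi> \<eta> \<rho> u = 1/2 * integral\<^sup>L M (cost_integrand q \<xi> \<eta> \<rho> u)"
  by (simp add: cost_def state_def Let_def cost_integrand_def[abs_def] cost_form_def stage_cost_def)

lemma integrable_cost_integrand:
  assumes "square_integrable M \<xi>" "\<forall>k<N. square_integrable M (q k)"
    and "\<forall>k<N. square_integrable M (\<eta> k)" "\<forall>k<N. square_integrable M (\<rho> k)"
    and "\<forall>k<N. square_integrable M (u k)"
  shows "integrable M (cost_integrand q \<xi> \<eta> \<rho> u)"
proof -
  have "square_integrable M (Y q \<xi> u N)" using assms by (intro square_integrable_Y) auto
  moreover have "square_integrable M (Ybar q \<xi> u k)" if "k < N" for k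
    using assms that by (intro square_integrable_Ybar) auto
  ultimately show ?thesis
    unfolding cost_integrand_def[abs_def] cost_form_def stage_cost_def using assms
    by (intro Bochner_Integration.integrable_add Bochner_Integration.integrable_sum
        integrable_mult_right integrable_inner_square_integrable square_integrable_mat_vec) auto
qed

lemma cost_integrand_convex_comb_AE:
  assumes \<xi>: "square_integrable M \<xi>" and q: "\<forall>k<N. square_integrable M (q k)"
    and u: "\<forall>k<N. square_integrable M (u k)" and v: "\<forall>k<N. square_integrable M (v k)"
  shows "AE x in M. cost_integrand q \<xi> \<eta> \<rho> (\<lambda>k x. t *\<^sub>R u k x + (1 - t) *\<^sub>R v k x) x
    = t * cost_integrand q \<xi> \<eta> \<rho> u x + (1 - t) * cost_integrand q \<xi> \<eta> \<rho> v x
      - t * (1 - t) * cost_integrand (\<lambda>_ _. 0) (\<lambda>_. 0) (\<lambda>_ _. 0) (\<lambda>_ _. 0) (\<lambda>k x. u k x - v k x) x"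
proof -
  define z where "z = (\<lambda>k x. t *\<^sub>R u k x + (1 - t) *\<^sub>R v k x)"
  define d where "d = (\<lambda>k x. u k x - v k x)"
  have "AE x in M. Y q \<xi> z N x = t *\<^sub>R Y q \<xi> u N x + (1 - t) *\<^sub>R Y q \<xi> v N x \<and>
      (\<forall>k\<in>{..<N}. Ybar q \<xi> z k x = t *\<^sub>R Ybar q \<xi> u k x + (1 - t) *\<^sub>R Ybar q \<xi> v k x)"
    by (rule state_lincomb_AE[OF \<xi> q u \<xi> q v]) (simp_all add: z_def scaleR_left_distrib[symmetric])
  moreover have "AE x in M. Y (\<lambda>_ _. 0) (\<lambda>_. 0) d N x = 1 *\<^sub>R Y q \<xi> u N x + (-1) *\<^sub>R Y q \<xi> v N x \<and>
      (\<forall>k\<in>{..<N}. Ybar (\<lambda>_ _. 0) (\<lambda>_. 0) d k x = 1 *\<^sub>R Ybar q \<xi> u k x + (-1) *\<^sub>R Ybar q \<xi> v k x)"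
    by (rule state_lincomb_AE[OF \<xi> q u \<xi> q v]) (simp_all add: d_def)
  ultimately have "AE x in M. cost_integrand q \<xi> \<eta> \<rho> z x
      = t * cost_integrand q \<xi> \<eta> \<rho> u x + (1 - t) * cost_integrand q \<xi> \<eta> \<rho> v x
        - t * (1 - t) * cost_integrand (\<lambda>_ _. 0) (\<lambda>_. 0) (\<lambda>_ _. 0) (\<lambda>_ _. 0) d x"
  proof eventually_elim
    case (elim x)
    have "cost_integrand q \<xi> \<eta> \<rho> z x = cost_form G0 Q S R N
        (t *\<^sub>R Y q \<xi> u N x + (1 - t) *\<^sub>R Y q \<xi> v N x)
        (\<lambda>k. t *\<^sub>R Ybar q \<xi> u k x + (1 - t) *\<^sub>R Ybar q \<xi> v k x)
        (\<lambda>k. t *\<^sub>R u k x + (1 - t) *\<^sub>R v k x) (\<lambda>k. \<eta> k x) (\<lambda>k. \<rho> k x)"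
      unfolding cost_integrand_def using elim by (intro cost_form_cong) (auto simp: z_def)
    also have "\<dots> = t * cost_integrand q \<xi> \<eta> \<rho> u x + (1 - t) * cost_integrand q \<xi> \<eta> \<rho> v x
        - t * (1 - t) * cost_form G0 Q S R N (Y q \<xi> u N x - Y q \<xi> v N x)
          (\<lambda>k. Ybar q \<xi> u k x - Ybar q \<xi> v k x) (\<lambda>k. u k x - v k x) (\<lambda>_. 0) (\<lambda>_. 0)"
      unfolding cost_integrand_def by (rule cost_form_convex_comb) simp
    also have "cost_form G0 Q S R N (Y q \<xi> u N x - Y q \<xi> v N x)
          (\<lambda>k. Ybar q \<xi> u k x - Ybar q \<xi> v k x) (\<lambda>k. u k x - v k x) (\<lambda>_. 0) (\<lambda>_. 0)
        = cost_integrand (\<lambda>_ _. 0) (\<lambda>_. 0) (\<lambda>_ _. 0) (\<lambda>_ _. 0) d x"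
      unfolding cost_integrand_def using elim by (intro cost_form_cong) (auto simp: d_def)
    finally show ?case .
  qed
  then show ?thesis unfolding z_def d_def .
qed

lemma cost_convex_comb:
  assumes data: "square_integrable M \<xi>" "\<forall>k<N. square_integrable M (q k)"
      "\<forall>k<N. square_integrable M (\<eta> k)" "\<forall>k<N. square_integrable M (\<rho> k)"
    and u: "\<forall>k<N. square_integrable M (u k)" and v: "\<forall>k<N. square_integrable M (v k)"
  shows "J q \<xi> \<eta> \<rho> (\<lambda>k x. t *\<^sub>R u k x + (1 - t) *\<^sub>R v k x)
    = t * J q \<xi> \<eta> \<rho> u + (1 - t) * J q \<xi> \<eta> \<rho> v - t * (1 - t) * J0 (\<lambda>k x. u k x - v k x)"
proof -
  define z where "z = (\<lambda>k x. t *\<^sub>R u k x + (1 - t) *\<^sub>R v k x)"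
  define d where "d = (\<lambda>k x. u k x - v k x)"
  define I where "I = cost_integrand q \<xi> \<eta> \<rho>"
  define I0 where "I0 = cost_integrand (\<lambda>_ _. 0) (\<lambda>_. 0) (\<lambda>_ _. 0) (\<lambda>_ _. 0)"
  have ae: "AE x in M. I z x = t * I u x + (1 - t) * I v x - t * (1 - t) * I0 d x"
    using cost_integrand_convex_comb_AE[OF data(1,2) u v] unfolding z_def d_def I_def I0_def .
  have "\<forall>k<N. square_integrable M (z k)" "\<forall>k<N. square_integrable M (d k)"
    using u v by (simp_all add: z_def d_def square_integrable_lincomb square_integrable_diff)
  then have "integrable M (I u)" "integrable M (I v)" "integrable M (I z)" "integrable M (I0 d)"
    unfolding I_def I0_def using data u v by (auto intro!: integrable_cost_integrand)
  with ae have integral_eq: "integral\<^sup>L M (I z) = t * integral\<^sup>L M (I u) + (1 - t) * integral\<^sup>L M (I v)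
      - t * (1 - t) * integral\<^sup>L M (I0 d)"
    by (subst integral_cong_AE[where g="\<lambda>x. t * I u x + (1 - t) * I v x - t * (1 - t) * I0 d x"]) auto
  have J_eq: "J q \<xi> \<eta> \<rho> z = 1/2 * integral\<^sup>L M (I z)" "J q \<xi> \<eta> \<rho> u = 1/2 * integral\<^sup>L M (I u)"
    "J q \<xi> \<eta> \<rho> v = 1/2 * integral\<^sup>L M (I v)" "J0 d = 1/2 * integral\<^sup>L M (I0 d)"
    by (simp_all only: cost_eq_integral I_def I0_def)
  show ?thesis
    unfolding z_def[symmetric] d_def[symmetric] J_eq integral_eq by (simp add: field_simps)
qed

lemma cost_strictly_convex:
  assumes data: "square_integrable M \<xi>" "\<forall>k<N. square_integrable M (q k)"
      "\<forall>k<N. square_integrable M (\<eta> k)" "\<forall>k<N. square_integrable M (\<rho> k)"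
    and J0_ge: "\<forall>u\<in>L2F M w N. r * Usq M N u \<le> J0 u" and r: "0 < r"
    and u: "u \<in> L2F M w N" and v: "v \<in> L2F M w N"
    and uv: "0 < Unorm M N (\<lambda>k x. u k x - v k x)" and t: "0 < t" "t < 1"
  shows "J q \<xi> \<eta> \<rho> (\<lambda>k x. t *\<^sub>R u k x + (1 - t) *\<^sub>R v k x) < t * J q \<xi> \<eta> \<rho> u + (1 - t) * J q \<xi> \<eta> \<rho> v"
proof -
  have "(\<lambda>k x. u k x - v k x) \<in> L2F M w N" using L2F_lincomb[OF u v, of 1 "-1"] by simp
  then have "r * Usq M N (\<lambda>k x. u k x - v k x) \<le> J0 (\<lambda>k x. u k x - v k x)" using J0_ge by blast
  moreover have "0 < r * Usq M N (\<lambda>k x. u k x - v k x)"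
    using r uv by (simp add: Unorm_eq_sqrt_Usq)
  ultimately have "0 < t * (1 - t) * J0 (\<lambda>k x. u k x - v k x)"
    using t by (intro mult_pos_pos) auto
  moreover have "\<forall>k<N. square_integrable M (u k)" "\<forall>k<N. square_integrable M (v k)"
    using u v by (auto intro: square_integrable_L2F)
  ultimately show ?thesis using cost_convex_comb[OF data] by simp
qed

definition state_energy :: "(nat \<Rightarrow> 'a \<Rightarrow> real^'n) \<Rightarrow> ('a \<Rightarrow> real^'n) \<Rightarrow> (nat \<Rightarrow> 'a \<Rightarrow> real^'m)
    \<Rightarrow> 'a \<Rightarrow> real" where
  "state_energy q \<xi> u x =
     (norm (Y q \<xi> u N x))\<^sup>2 + (\<Sum>k<N. 2 * (norm (Ybar q \<xi> u k x))\<^sup>2 + 2 * (norm (u k x))\<^sup>2)"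

definition data_energy :: "(nat \<Rightarrow> 'a \<Rightarrow> real^'n) \<Rightarrow> ('a \<Rightarrow> real^'n) \<Rightarrow> (nat \<Rightarrow> 'a \<Rightarrow> real^'n)
    \<Rightarrow> (nat \<Rightarrow> 'a \<Rightarrow> real^'m) \<Rightarrow> 'a \<Rightarrow> real" where
  "data_energy q \<xi> \<eta> \<rho> x =
     state_energy q \<xi> (\<lambda>_ _. 0) x + (\<Sum>k<N. (norm (\<eta> k x))\<^sup>2 + (norm (\<rho> k x))\<^sup>2)"

lemma integral_state_energy:
  assumes "square_integrable M \<xi>" "\<forall>k<N. square_integrable M (q k)"
    and "\<forall>k<N. square_integrable M (u k)"
  shows "integrable M (state_energy q \<xi> u)"
    and "integral\<^sup>L M (state_energy q \<xi> u) = (\<integral>x. (norm (Y q \<xi> u N x))\<^sup>2 \<partial>M)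
      + (\<Sum>k<N. 2 * (\<integral>x. (norm (Ybar q \<xi> u k x))\<^sup>2 \<partial>M) + 2 * (\<integral>x. (norm (u k x))\<^sup>2 \<partial>M))"
proof -
  have Y: "integrable M (\<lambda>x. (norm (Y q \<xi> u N x))\<^sup>2)"
    using square_integrable_Y[OF assms] by (simp add: square_integrable_def)
  have Ybar: "integrable M (\<lambda>x. (norm (Ybar q \<xi> u k x))\<^sup>2)" "integrable M (\<lambda>x. (norm (u k x))\<^sup>2)"
    if "k < N" for k
    using square_integrable_Ybar(1)[OF assms that] assms(3) that by (simp_all add: square_integrable_def)
  show "integrable M (state_energy q \<xi> u)"
    unfolding state_energy_def[abs_def] using Y Ybar
    by (intro Bochner_Integration.integrable_add Bochner_Integration.integrable_sum integrable_mult_right) auto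
  have summand: "integrable M (\<lambda>x. 2 * (norm (Ybar q \<xi> u k x))\<^sup>2 + 2 * (norm (u k x))\<^sup>2)"
    if "k < N" for k
    using Ybar[OF that] by simp
  have "integral\<^sup>L M (state_energy q \<xi> u) = (\<integral>x. (norm (Y q \<xi> u N x))\<^sup>2 \<partial>M)
      + (\<integral>x. (\<Sum>k<N. 2 * (norm (Ybar q \<xi> u k x))\<^sup>2 + 2 * (norm (u k x))\<^sup>2) \<partial>M)"
    unfolding state_energy_def[abs_def] using Y summand
    by (intro Bochner_Integration.integral_add Bochner_Integration.integrable_sum) auto
  also have "(\<integral>x. (\<Sum>k<N. 2 * (norm (Ybar q \<xi> u k x))\<^sup>2 + 2 * (norm (u k x))\<^sup>2) \<partial>M)
      = (\<Sum>k<N. \<integral>x. 2 * (norm (Ybar q \<xi> u k x))\<^sup>2 + 2 * (norm (u k x))\<^sup>2 \<partial>M)"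
    using summand by (intro Bochner_Integration.integral_sum) auto
  also have "\<dots> = (\<Sum>k<N. 2 * (\<integral>x. (norm (Ybar q \<xi> u k x))\<^sup>2 \<partial>M) + 2 * (\<integral>x. (norm (u k x))\<^sup>2 \<partial>M))"
    using Ybar by (intro sum.cong) simp_all
  finally show "integral\<^sup>L M (state_energy q \<xi> u) = (\<integral>x. (norm (Y q \<xi> u N x))\<^sup>2 \<partial>M)
      + (\<Sum>k<N. 2 * (\<integral>x. (norm (Ybar q \<xi> u k x))\<^sup>2 \<partial>M) + 2 * (\<integral>x. (norm (u k x))\<^sup>2 \<partial>M))" .
qed

lemma homogeneous_state_energy_le:
  "\<exists>C\<ge>0. \<forall>u. (\<forall>k<N. square_integrable M (u k)) \<longrightarrow>
     integral\<^sup>L M (state_energy (\<lambda>_ _. 0) (\<lambda>_. 0) u) \<le> C * Usq M N u"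
proof -
  obtain D where D: "0 \<le> D" "\<forall>u. (\<forall>k<N. square_integrable M (u k)) \<longrightarrow>
      (\<forall>j\<le>N. (\<integral>x. (norm (Y (\<lambda>_ _. 0) (\<lambda>_. 0) u j x))\<^sup>2 \<partial>M) \<le> D * Usq M N u)"
    using Y_homogeneous_square_integral_le by blast
  show ?thesis
  proof (intro exI[of _ "(2 * real N + 1) * D + 2"] conjI allI impI)
    show "0 \<le> (2 * real N + 1) * D + 2" using D(1) by simp
    fix u :: "nat \<Rightarrow> 'a \<Rightarrow> real^'m"
    assume u: "\<forall>k<N. square_integrable M (u k)"
    have zero: "\<forall>k<N. square_integrable M ((\<lambda>_ _. 0 :: real^'n) k)" by simp
    have Ybar: "(\<integral>x. (norm (Ybar (\<lambda>_ _. 0) (\<lambda>_. 0) u k x))\<^sup>2 \<partial>M) \<le> D * Usq M N u" if "k < N" for k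
    proof -
      have "(\<integral>x. (norm (Ybar (\<lambda>_ _. 0) (\<lambda>_. 0) u k x))\<^sup>2 \<partial>M)
          \<le> (\<integral>x. (norm (Y (\<lambda>_ _. 0) (\<lambda>_. 0) u (N - Suc k) x))\<^sup>2 \<partial>M)"
        using square_integrable_Ybar(2)[of "\<lambda>_. 0" "\<lambda>_ _. 0" u k] u that by simp
      also have "\<dots> \<le> D * Usq M N u" using D(2) u by simp
      finally show ?thesis .
    qed
    have "integral\<^sup>L M (state_energy (\<lambda>_ _. 0) (\<lambda>_. 0) u)
        \<le> D * Usq M N u + (\<Sum>k<N. 2 * (D * Usq M N u) + 2 * (\<integral>x. (norm (u k x))\<^sup>2 \<partial>M))"
      unfolding integral_state_energy(2)[OF square_integrable_zero zero u]
      using D(2) u Ybar by (intro add_mono sum_mono) auto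
    also have "\<dots> = ((2 * real N + 1) * D + 2) * Usq M N u"
      by (simp add: Usq_eq_sum[OF u] sum.distrib sum_distrib_left[symmetric] algebra_simps)
    finally show "integral\<^sup>L M (state_energy (\<lambda>_ _. 0) (\<lambda>_. 0) u) \<le> ((2 * real N + 1) * D + 2) * Usq M N u" .
  qed
qed

lemma cost_integrand_add_ge_AE:
  assumes \<xi>: "square_integrable M \<xi>" and q: "\<forall>k<N. square_integrable M (q k)"
    and u: "\<forall>k<N. square_integrable M (u k)"
    and e: "0 < e" and K: "1 \<le> K" "\<And>x. norm (G0 *v x) \<le> K * norm x"
      "\<And>k x. k < N \<Longrightarrow> norm (Q k *v x) \<le> K * norm x" "\<And>k x. k < N \<Longrightarrow> norm (S k *v x) \<le> K * norm x"
  shows "AE x in M. cost_integrand q \<xi> \<eta> \<rho> (\<lambda>_ _. 0) x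
      + cost_integrand (\<lambda>_ _. 0) (\<lambda>_. 0) (\<lambda>_ _. 0) (\<lambda>_ _. 0) u x
      - K\<^sup>2 / e * data_energy q \<xi> \<eta> \<rho> x - e * state_energy (\<lambda>_ _. 0) (\<lambda>_. 0) u x
    \<le> cost_integrand q \<xi> \<eta> \<rho> u x"
proof -
  have "AE x in M. Y q \<xi> u N x = 1 *\<^sub>R Y q \<xi> (\<lambda>_ _. 0) N x + 1 *\<^sub>R Y (\<lambda>_ _. 0) (\<lambda>_. 0) u N x \<and>
      (\<forall>k\<in>{..<N}. Ybar q \<xi> u k x = 1 *\<^sub>R Ybar q \<xi> (\<lambda>_ _. 0) k x + 1 *\<^sub>R Ybar (\<lambda>_ _. 0) (\<lambda>_. 0) u k x)"
    by (rule state_lincomb_AE[OF \<xi> q _ square_integrable_zero _ u]) simp_all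
  then show ?thesis
  proof eventually_elim
    case (elim x)
    have "cost_integrand q \<xi> \<eta> \<rho> (\<lambda>_ _. 0) x + cost_integrand (\<lambda>_ _. 0) (\<lambda>_. 0) (\<lambda>_ _. 0) (\<lambda>_ _. 0) u x
      - K\<^sup>2 / e * data_energy q \<xi> \<eta> \<rho> x - e * state_energy (\<lambda>_ _. 0) (\<lambda>_. 0) u x
      = cost_form G0 Q S R N (Y q \<xi> (\<lambda>_ _. 0) N x) (\<lambda>k. Ybar q \<xi> (\<lambda>_ _. 0) k x) (\<lambda>_. 0)
          (\<lambda>k. \<eta> k x) (\<lambda>k. \<rho> k x)
        + cost_form G0 Q S R N (Y (\<lambda>_ _. 0) (\<lambda>_. 0) u N x) (\<lambda>k. Ybar (\<lambda>_ _. 0) (\<lambda>_. 0) u k x)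
          (\<lambda>k. u k x) (\<lambda>_. 0) (\<lambda>_. 0)
        - K\<^sup>2 / e * ((norm (Y q \<xi> (\<lambda>_ _. 0) N x))\<^sup>2 + (\<Sum>k<N. 2 * (norm (Ybar q \<xi> (\<lambda>_ _. 0) k x))\<^sup>2
          + (norm (\<eta> k x))\<^sup>2 + (norm (\<rho> k x))\<^sup>2))
        - e * ((norm (Y (\<lambda>_ _. 0) (\<lambda>_. 0) u N x))\<^sup>2
          + (\<Sum>k<N. 2 * (norm (Ybar (\<lambda>_ _. 0) (\<lambda>_. 0) u k x))\<^sup>2 + 2 * (norm (u k x))\<^sup>2))"
      by (simp add: cost_integrand_def data_energy_def state_energy_def sum.distrib add.assoc)
    also have "\<dots> \<le> cost_form G0 Q S R N (Y q \<xi> (\<lambda>_ _. 0) N x + Y (\<lambda>_ _. 0) (\<lambda>_. 0) u N x)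
        (\<lambda>k. Ybar q \<xi> (\<lambda>_ _. 0) k x + Ybar (\<lambda>_ _. 0) (\<lambda>_. 0) u k x) (\<lambda>k. u k x) (\<lambda>k. \<eta> k x) (\<lambda>k. \<rho> k x)"
      by (rule cost_form_add_ge[OF e K])
    also have "\<dots> = cost_integrand q \<xi> \<eta> \<rho> u x"
      unfolding cost_integrand_def using elim by (intro cost_form_cong) auto
    finally show ?case .
  qed
qed

lemma cost_ge_split:
  assumes \<xi>: "square_integrable M \<xi>" and q: "\<forall>k<N. square_integrable M (q k)"
    and \<eta>: "\<forall>k<N. square_integrable M (\<eta> k)" and \<rho>: "\<forall>k<N. square_integrable M (\<rho> k)"
    and u: "\<forall>k<N. square_integrable M (u k)"
    and e: "0 < e" and K: "1 \<le> K" "\<And>x. norm (G0 *v x) \<le> K * norm x"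
      "\<And>k x. k < N \<Longrightarrow> norm (Q k *v x) \<le> K * norm x" "\<And>k x. k < N \<Longrightarrow> norm (S k *v x) \<le> K * norm x"
  shows "2 * J q \<xi> \<eta> \<rho> (\<lambda>_ _. 0) + 2 * J0 u - K\<^sup>2 / e * integral\<^sup>L M (data_energy q \<xi> \<eta> \<rho>)
      - e * integral\<^sup>L M (state_energy (\<lambda>_ _. 0) (\<lambda>_. 0) u)
    \<le> 2 * J q \<xi> \<eta> \<rho> u"
proof -
  define I where "I = cost_integrand q \<xi> \<eta> \<rho>"
  define I0 where "I0 = cost_integrand (\<lambda>_ _. 0) (\<lambda>_. 0) (\<lambda>_ _. 0) (\<lambda>_ _. 0)"
  define E where "E = state_energy (\<lambda>_ _. 0) (\<lambda>_. 0) u"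
  define P where "P = data_energy q \<xi> \<eta> \<rho>"
  have zero_u: "\<forall>k<N. square_integrable M ((\<lambda>_ _. 0 :: real^'m) k)"
    and zero_q: "\<forall>k<N. square_integrable M ((\<lambda>_ _. 0 :: real^'n) k)" by simp_all
  have integrable: "integrable M (I (\<lambda>_ _. 0))" "integrable M (I0 u)" "integrable M (I u)"
    "integrable M E"
    unfolding I_def I0_def E_def using \<xi> q \<eta> \<rho> u zero_u zero_q
    by (auto intro!: integrable_cost_integrand integral_state_energy(1))
  have P: "integrable M P"
    unfolding P_def data_energy_def[abs_def] using integral_state_energy(1)[OF \<xi> q zero_u] \<eta> \<rho>
    by (intro Bochner_Integration.integrable_add Bochner_Integration.integrable_sum)
      (auto simp: square_integrable_def)
  have "integral\<^sup>L M (I (\<lambda>_ _. 0)) + integral\<^sup>L M (I0 u) - K\<^sup>2 / e * integral\<^sup>L M P - e * integral\<^sup>L M E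
      = (\<integral>x. I (\<lambda>_ _. 0) x + I0 u x - K\<^sup>2 / e * P x - e * E x \<partial>M)"
    using integrable P by simp
  also have "\<dots> \<le> integral\<^sup>L M (I u)"
    using integrable P cost_integrand_add_ge_AE[OF \<xi> q u e K, of \<eta> \<rho>]
    unfolding I_def I0_def E_def P_def by (intro integral_mono_AE) auto
  finally have "integral\<^sup>L M (I (\<lambda>_ _. 0)) + integral\<^sup>L M (I0 u) - K\<^sup>2 / e * integral\<^sup>L M P
      - e * integral\<^sup>L M E \<le> integral\<^sup>L M (I u)" .
  moreover have "J q \<xi> \<eta> \<rho> u = 1/2 * integral\<^sup>L M (I u)"
    "J q \<xi> \<eta> \<rho> (\<lambda>_ _. 0) = 1/2 * integral\<^sup>L M (I (\<lambda>_ _. 0))" "J0 u = 1/2 * integral\<^sup>L M (I0 u)"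
    by (simp_all only: cost_eq_integral I_def I0_def)
  ultimately show ?thesis unfolding E_def P_def by linarith
qed

lemma cost_ge_homogeneous_cost:
  assumes \<xi>: "square_integrable M \<xi>" and q: "\<forall>k<N. square_integrable M (q k)"
    and \<eta>: "\<forall>k<N. square_integrable M (\<eta> k)" and \<rho>: "\<forall>k<N. square_integrable M (\<rho> k)"
    and e: "0 < e"
  shows "\<exists>c. \<forall>u. (\<forall>k<N. square_integrable M (u k)) \<longrightarrow> c + J0 u - e * Usq M N u \<le> J q \<xi> \<eta> \<rho> u"
proof -
  obtain K where K: "1 \<le> K" "\<And>x. norm (G0 *v x) \<le> K * norm x"
      "\<And>k x. k < N \<Longrightarrow> norm (Q k *v x) \<le> K * norm x" "\<And>k x. k < N \<Longrightarrow> norm (S k *v x) \<le> K * norm x"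
    using mat_vec_uniform_bound[where G=G0 and Q=Q and S=S and N=N] by blast
  obtain C where C: "0 \<le> C" "\<forall>u. (\<forall>k<N. square_integrable M (u k)) \<longrightarrow>
      integral\<^sup>L M (state_energy (\<lambda>_ _. 0) (\<lambda>_. 0) u) \<le> C * Usq M N u"
    using homogeneous_state_energy_le by blast
  define e' where "e' = e / (C + 1)"
  have e': "0 < e'" using e C(1) by (simp add: e'_def)
  have e'C: "e' * C \<le> e" using e C(1) by (simp add: e'_def field_simps)
  show ?thesis
  proof (intro exI[of _ "J q \<xi> \<eta> \<rho> (\<lambda>_ _. 0) - 1/2 * (K\<^sup>2 / e' * integral\<^sup>L M (data_energy q \<xi> \<eta> \<rho>))"]
      allI impI)
    fix u :: "nat \<Rightarrow> 'a \<Rightarrow> real^'m"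
    assume u: "\<forall>k<N. square_integrable M (u k)"
    have "e' * integral\<^sup>L M (state_energy (\<lambda>_ _. 0) (\<lambda>_. 0) u) \<le> e' * (C * Usq M N u)"
      using C(2) u e' by (intro mult_left_mono) auto
    also have "\<dots> \<le> e * Usq M N u"
      using mult_right_mono[OF e'C Usq_nonneg[of M N u]] by (simp add: mult.assoc)
    moreover have "0 \<le> e * Usq M N u" by (rule mult_nonneg_nonneg[OF less_imp_le[OF e] Usq_nonneg])
    ultimately show "J q \<xi> \<eta> \<rho> (\<lambda>_ _. 0) - 1/2 * (K\<^sup>2 / e' * integral\<^sup>L M (data_energy q \<xi> \<eta> \<rho>))
        + J0 u - e * Usq M N u \<le> J q \<xi> \<eta> \<rho> u"
      using cost_ge_split[OF \<xi> q \<eta> \<rho> u e' K] by linarith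
  qed
qed

lemma cost_coercive:
  assumes \<xi>: "square_integrable M \<xi>" and q: "\<forall>k<N. square_integrable M (q k)"
    and \<eta>: "\<forall>k<N. square_integrable M (\<eta> k)" and \<rho>: "\<forall>k<N. square_integrable M (\<rho> k)"
    and J0_ge: "\<forall>u\<in>L2F M w N. r * Usq M N u \<le> J0 u" and r: "0 < r"
  shows "\<exists>K. \<forall>u\<in>L2F M w N. K < Unorm M N u \<longrightarrow> c < J q \<xi> \<eta> \<rho> u"
proof -
  obtain c0 where c0: "\<And>u. \<forall>k<N. square_integrable M (u k) \<Longrightarrow>
      c0 + J0 u - r / 2 * Usq M N u \<le> J q \<xi> \<eta> \<rho> u"
    using cost_ge_homogeneous_cost[OF \<xi> q \<eta> \<rho>, of "r / 2"] r by auto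
  show ?thesis
  proof (intro exI[of _ "sqrt (max 0 (2 * (c - c0) / r))"] ballI impI)
    fix u :: "nat \<Rightarrow> 'a \<Rightarrow> real^'m"
    assume u: "u \<in> L2F M w N" and large: "sqrt (max 0 (2 * (c - c0) / r)) < Unorm M N u"
    have "2 * (c - c0) / r < Usq M N u" using large by (simp add: Unorm_eq_sqrt_Usq)
    then have "c - c0 < r / 2 * Usq M N u" using r by (simp add: field_simps)
    moreover have "r * Usq M N u \<le> J0 u" using J0_ge u by blast
    moreover have "c0 + J0 u - r / 2 * Usq M N u \<le> J q \<xi> \<eta> \<rho> u"
      using u by (intro c0) (auto intro: square_integrable_L2F)
    ultimately show "c < J q \<xi> \<eta> \<rho> u" by linarith
  qed
qed

end

theorem lemma3p4:
  fixes M :: "'a measure" and w :: "nat \<Rightarrow> 'a \<Rightarrow> real" and N :: nat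
    and A C :: "nat \<Rightarrow> real^'n^'n" and B :: "nat \<Rightarrow> real^'m^'n"
    and q \<eta> :: "nat \<Rightarrow> 'a \<Rightarrow> real^'n" and \<rho> :: "nat \<Rightarrow> 'a \<Rightarrow> real^'m"
    and G0 :: "real^'n^'n" and Q :: "nat \<Rightarrow> real^'n^'n" and R :: "nat \<Rightarrow> real^'m^'m"
    and S :: "nat \<Rightarrow> real^'n^'m" and r :: real and \<xi> :: "'a \<Rightarrow> real^'n"
  assumes "prob_space M" and "complete_measure M" and "N \<ge> 1"
    and "\<forall>k<N. w k \<in> borel_measurable M \<and> integrable M (\<lambda>x. (w k x)\<^sup>2)"
    and "\<forall>k<N. AE x in M. real_cond_exp M (Fm M w k) (w k) x = 0"
    and "\<forall>k<N. AE x in M. real_cond_exp M (Fm M w k) (\<lambda>z. (w k z)\<^sup>2) x = 1"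
    and "q \<in> L2F M w N" and "\<eta> \<in> L2F M w N" and "\<rho> \<in> L2F M w N"
    and "transpose G0 = G0"
    and "\<forall>k<N. transpose (Q k) = Q k \<and> transpose (R k) = R k"
    and "r > 0"
    and "\<forall>u \<in> L2F M w N.
           cost M w N A B C (\<lambda>_ _. 0) G0 Q S R (\<lambda>_ _. 0) (\<lambda>_ _. 0) (\<lambda>_. 0) u
             \<ge> r * integral\<^sup>L M (\<lambda>x. \<Sum>k<N. (norm (u k x))\<^sup>2)"
    and "\<xi> \<in> borel_measurable (Fm M w N)" and "integrable M (\<lambda>x. (norm (\<xi> x))\<^sup>2)"
  shows "(\<forall>u \<in> L2F M w N. \<forall>v \<in> L2F M w N. \<forall>t::real.
            Unorm M N (\<lambda>k x. u k x - v k x) > 0 \<and> 0 < t \<and> t < 1 \<longrightarrow>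
              cost M w N A B C q G0 Q S R \<eta> \<rho> \<xi> (\<lambda>k x. t *\<^sub>R u k x + (1 - t) *\<^sub>R v k x)
              < t * cost M w N A B C q G0 Q S R \<eta> \<rho> \<xi> u
                + (1 - t) * cost M w N A B C q G0 Q S R \<eta> \<rho> \<xi> v)
       \<and> (\<forall>c::real. \<exists>K::real. \<forall>u \<in> L2F M w N.
            Unorm M N u > K \<longrightarrow> cost M w N A B C q G0 Q S R \<eta> \<rho> \<xi> u > c)"
proof -
  interpret lq_problem M w N A B C G0 Q S R
    using assms(4,6) by (intro lq_problem.intro[OF assms(1)] lq_problem_axioms.intro) auto
  have "\<xi> \<in> borel_measurable M"
    by (rule measurable_from_subalg[OF subalgebra_Fm[OF order_refl] assms(14)])
  then have \<xi>: "square_integrable M \<xi>"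
    using assms(15) by (simp add: square_integrable_def)
  have data: "\<forall>k<N. square_integrable M (q k)" "\<forall>k<N. square_integrable M (\<eta> k)"
    "\<forall>k<N. square_integrable M (\<rho> k)"
    using assms(7-9) by (auto intro: square_integrable_L2F)
  have J0_ge: "\<forall>u\<in>L2F M w N. r * Usq M N u \<le> J0 u"
    using assms(13) by (simp add: Usq_def)
  show ?thesis
  proof (intro conjI ballI allI impI)
    fix u v :: "nat \<Rightarrow> 'a \<Rightarrow> real^'m" and t :: real
    assume "u \<in> L2F M w N" "v \<in> L2F M w N" "0 < Unorm M N (\<lambda>k x. u k x - v k x) \<and> 0 < t \<and> t < 1"
    then show "J q \<xi> \<eta> \<rho> (\<lambda>k x. t *\<^sub>R u k x + (1 - t) *\<^sub>R v k x) < t * J q \<xi> \<eta> \<rho> u + (1 - t) * J q \<xi> \<eta> \<rho> v"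
      by (intro cost_strictly_convex[OF \<xi> data J0_ge assms(12)]) auto
  next
    fix c :: real
    show "\<exists>K. \<forall>u\<in>L2F M w N. K < Unorm M N u \<longrightarrow> c < J q \<xi> \<eta> \<rho> u"
      by (rule cost_coercive[OF \<xi> data J0_ge assms(12)])
  qed
qed

end
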